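(* Let $p$ be a prime and let $d,w$ be positive integers such that $w\mid p^d+1$. Put $z_1=\frac{p^d+1}{w}$ and let $z_2\in\{w-1,w\}$. Then there exists a uniform $(z_1,p^{2d},k,\lambda,\mu,t)$-partial sum family $\{S_{i,j}\}_{0\le i,j\le z_1-1}$ (in some finite abelian group of order $p^{2d}$) with $$k=(p^d-1)w+(z_1-1)z_2p^d,\quad \lambda=p^d+w^2-3w+(z_1-1)z_2^2,$$ $$\mu=w^2-w+(z_1-1)z_2^2,\quad t=p^dw-w+(z_1-1)z_2^2.$$
   Context: Let $G$ be a finite abelian group of order $n$, written additively, with identity $0$. A subset $S\subseteq G$ is identified with the element $\sum_{g\in S}g$ of the group ring $\mathbb{Z}[G]$. A family $\{S_{i,j}\}_{0\le i,j\le m-1}$ of subsets of $G$ is an $(m,n,k,\lambda,\mu,t)$-partial sum family if (1) $0\notin S_{i,i}$ for all $i$; (2) $\sum_{j=0}^{m-1}|S_{i,j}|=\sum_{j=0}^{m-1}|S_{j,i}|=k$ for all $i$; (3) for all $0\le i,j\le m-1$, in $\mathbb{Z}[G]$ one has $\sum_{l=0}^{m-1}S_{l,j}S_{i,l}=\mu G+\beta S_{i,j}+\delta_{i,j}\gamma e$, where $e$ is the group identity viewed in $\mathbb{Z}[G]$, $\beta=\lambda-\mu$, $\gamma=t-\mu$ and $\delta_{i,j}$ is the Kronecker delta. Such a family is uniform if: the sizes $|S_{i,i}|$ are all equal; the sizes $|S_{i,j}|$ with $i\neq j$ are all equal; and $\{S_{i,i}:0\le i\le m-1\}$ is a partition of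 $G\setminus\{0\}$. *)

theory Defs
  imports "HOL-Algebra.Algebra" "HOL-Library.Disjoint_Sets" "HOL-Library.Indicator_Function"
    "HOL-Computational_Algebra.Primes"
begin

(* Groups are written multiplicatively, following HOL-Algebra: the operation is
   \<otimes> and the identity is \<one>. *)

(* The group ring Z[G] of a finite group G: an element is the function of its coefficients,
   extended by 0 outside carrier G. *)
definition int_group_ring :: "('a, 'b) monoid_scheme \<Rightarrow> ('a \<Rightarrow> int) ring" where
  "int_group_ring G =
    \<lparr> carrier = {f. \<forall>x. x \<notin> carrier G \<longrightarrow> f x = 0},
      monoid.mult = (\<lambda>f g x. if x \<in> carrier G
                     then \<Sum>y\<in>carrier G. f y * g (inv\<^bsub>G\<^esub> y \<otimes>\<^bsub>G\<^esub> x) else 0),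
      one = indicator {\<one>\<^bsub>G\<^esub>},
      ring.zero = (\<lambda>x. 0),
      add = (\<lambda>f g x. f x + g x) \<rparr>"

lemma cring_int_group_ring:
  assumes "comm_group G" and fin: "finite (carrier G)"
  shows "cring (int_group_ring G)"
proof -
  interpret G: comm_group G by fact
  let ?R = "int_group_ring G"
  let ?C = "carrier G"
  have comm: "f \<otimes>\<^bsub>?R\<^esub> g = g \<otimes>\<^bsub>?R\<^esub> f" for f g
  proof
    fix x
    have "(\<Sum>y\<in>?C. f y * g (inv\<^bsub>G\<^esub> y \<otimes>\<^bsub>G\<^esub> x)) = (\<Sum>y\<in>?C. g y * f (inv\<^bsub>G\<^esub> y \<otimes>\<^bsub>G\<^esub> x))"
      if x: "x \<in> ?C"
    proof (rule sum.reindex_bij_witness[where i = "\<lambda>y. inv\<^bsub>G\<^esub> y \<otimes>\<^bsub>G\<^esub> x" and j = "\<lambda>y. inv\<^bsub>G\<^esub> y \<otimes>\<^bsub>G\<^esub> x"])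
      fix y assume y: "y \<in> ?C"
      show "inv\<^bsub>G\<^esub> (inv\<^bsub>G\<^esub> y \<otimes>\<^bsub>G\<^esub> x) \<otimes>\<^bsub>G\<^esub> x = y"
        using x y by (simp add: G.inv_mult G.m_assoc)
      then show "inv\<^bsub>G\<^esub> (inv\<^bsub>G\<^esub> y \<otimes>\<^bsub>G\<^esub> x) \<otimes>\<^bsub>G\<^esub> x = y" .
      then show "g (inv\<^bsub>G\<^esub> y \<otimes>\<^bsub>G\<^esub> x) * f (inv\<^bsub>G\<^esub> (inv\<^bsub>G\<^esub> y \<otimes>\<^bsub>G\<^esub> x) \<otimes>\<^bsub>G\<^esub> x) = f y * g (inv\<^bsub>G\<^esub> y \<otimes>\<^bsub>G\<^esub> x)"
        by simp
    qed (use x in auto)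
    then show "(f \<otimes>\<^bsub>?R\<^esub> g) x = (g \<otimes>\<^bsub>?R\<^esub> f) x"
      by (simp add: int_group_ring_def)
  qed
  have assoc: "(f \<otimes>\<^bsub>?R\<^esub> g) \<otimes>\<^bsub>?R\<^esub> h = f \<otimes>\<^bsub>?R\<^esub> (g \<otimes>\<^bsub>?R\<^esub> h)" for f g h
  proof
    fix x
    have "(\<Sum>y\<in>?C. (\<Sum>z\<in>?C. f z * g (inv\<^bsub>G\<^esub> z \<otimes>\<^bsub>G\<^esub> y)) * h (inv\<^bsub>G\<^esub> y \<otimes>\<^bsub>G\<^esub> x))
        = (\<Sum>z\<in>?C. f z * (\<Sum>y\<in>?C. g y * h (inv\<^bsub>G\<^esub> y \<otimes>\<^bsub>G\<^esub> (inv\<^bsub>G\<^esub> z \<otimes>\<^bsub>G\<^esub> x))))" if x: "x \<in> ?C"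
    proof -
      have "(\<Sum>y\<in>?C. (\<Sum>z\<in>?C. f z * g (inv\<^bsub>G\<^esub> z \<otimes>\<^bsub>G\<^esub> y)) * h (inv\<^bsub>G\<^esub> y \<otimes>\<^bsub>G\<^esub> x))
          = (\<Sum>z\<in>?C. \<Sum>y\<in>?C. f z * (g (inv\<^bsub>G\<^esub> z \<otimes>\<^bsub>G\<^esub> y) * h (inv\<^bsub>G\<^esub> y \<otimes>\<^bsub>G\<^esub> x)))"
        unfolding sum_distrib_right by (subst sum.swap) (simp add: mult.assoc)
      also have "\<dots> = (\<Sum>z\<in>?C. \<Sum>y\<in>?C. f z * (g y * h (inv\<^bsub>G\<^esub> y \<otimes>\<^bsub>G\<^esub> (inv\<^bsub>G\<^esub> z \<otimes>\<^bsub>G\<^esub> x))))"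
      proof (rule sum.cong[OF refl])
        fix z assume z: "z \<in> ?C"
        show "(\<Sum>y\<in>?C. f z * (g (inv\<^bsub>G\<^esub> z \<otimes>\<^bsub>G\<^esub> y) * h (inv\<^bsub>G\<^esub> y \<otimes>\<^bsub>G\<^esub> x)))
            = (\<Sum>y\<in>?C. f z * (g y * h (inv\<^bsub>G\<^esub> y \<otimes>\<^bsub>G\<^esub> (inv\<^bsub>G\<^esub> z \<otimes>\<^bsub>G\<^esub> x))))"
        proof (rule sum.reindex_bij_witness[where i = "\<lambda>y. z \<otimes>\<^bsub>G\<^esub> y" and j = "\<lambda>y. inv\<^bsub>G\<^esub> z \<otimes>\<^bsub>G\<^esub> y"])
          fix y assume y: "y \<in> ?C"
          have "inv\<^bsub>G\<^esub> (inv\<^bsub>G\<^esub> z \<otimes>\<^bsub>G\<^esub> y) \<otimes>\<^bsub>G\<^esub> (inv\<^bsub>G\<^esub> z \<otimes>\<^bsub>G\<^esub> x) = inv\<^bsub>G\<^esub> y \<otimes>\<^bsub>G\<^esub> (z \<otimes>\<^bsub>G\<^esub> inv\<^bsub>G\<^esub> z) \<otimes>\<^bsub>G\<^esub> x"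
            using x y z by (simp only: G.inv_mult_group G.m_assoc G.inv_inv G.inv_closed G.m_closed)
          also have "\<dots> = inv\<^bsub>G\<^esub> y \<otimes>\<^bsub>G\<^esub> x" using x y z by simp
          finally show "f z * (g (inv\<^bsub>G\<^esub> z \<otimes>\<^bsub>G\<^esub> y) * h (inv\<^bsub>G\<^esub> (inv\<^bsub>G\<^esub> z \<otimes>\<^bsub>G\<^esub> y) \<otimes>\<^bsub>G\<^esub> (inv\<^bsub>G\<^esub> z \<otimes>\<^bsub>G\<^esub> x)))
              = f z * (g (inv\<^bsub>G\<^esub> z \<otimes>\<^bsub>G\<^esub> y) * h (inv\<^bsub>G\<^esub> y \<otimes>\<^bsub>G\<^esub> x))" by simp
        qed (use x z in \<open>auto simp flip: G.m_assoc\<close>)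
      qed
      finally show ?thesis by (simp add: sum_distrib_left)
    qed
    then show "((f \<otimes>\<^bsub>?R\<^esub> g) \<otimes>\<^bsub>?R\<^esub> h) x = (f \<otimes>\<^bsub>?R\<^esub> (g \<otimes>\<^bsub>?R\<^esub> h)) x"
      by (simp add: int_group_ring_def)
  qed
  have unit: "\<one>\<^bsub>?R\<^esub> \<otimes>\<^bsub>?R\<^esub> f = f" if f: "f \<in> carrier ?R" for f
  proof
    fix x
    have "(\<Sum>y\<in>?C. indicator {\<one>\<^bsub>G\<^esub>} y * f (inv\<^bsub>G\<^esub> y \<otimes>\<^bsub>G\<^esub> x)) = f x" if "x \<in> ?C"
    proof -
      have "(\<Sum>y\<in>?C. indicator {\<one>\<^bsub>G\<^esub>} y * f (inv\<^bsub>G\<^esub> y \<otimes>\<^bsub>G\<^esub> x)) =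
          (\<Sum>y\<in>?C. if y = \<one>\<^bsub>G\<^esub> then f (inv\<^bsub>G\<^esub> y \<otimes>\<^bsub>G\<^esub> x) else 0)"
        by (intro sum.cong) (auto simp: indicator_def)
      also have "\<dots> = f x" using that by (simp add: sum.delta fin)
      finally show ?thesis .
    qed
    then show "(\<one>\<^bsub>?R\<^esub> \<otimes>\<^bsub>?R\<^esub> f) x = f x"
      using f by (simp add: int_group_ring_def)
  qed
  show ?thesis
  proof (rule cringI)
    show "abelian_group ?R"
    proof (rule abelian_groupI)
      fix f assume "f \<in> carrier ?R"
      then show "\<exists>g\<in>carrier ?R. g \<oplus>\<^bsub>?R\<^esub> f = \<zero>\<^bsub>?R\<^esub>"
        by (intro bexI[of _ "\<lambda>x. - f x"]) (auto simp: int_group_ring_def)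
    qed (auto simp: int_group_ring_def)
    show "Group.comm_monoid ?R"
    proof (rule comm_monoidI)
      show "f \<otimes>\<^bsub>?R\<^esub> g \<in> carrier ?R" for f g by (simp add: int_group_ring_def)
      show "\<one>\<^bsub>?R\<^esub> \<in> carrier ?R" by (auto simp: int_group_ring_def indicator_def)
    qed (erule unit | rule assoc comm)+
    show "(f \<oplus>\<^bsub>?R\<^esub> g) \<otimes>\<^bsub>?R\<^esub> h = f \<otimes>\<^bsub>?R\<^esub> h \<oplus>\<^bsub>?R\<^esub> g \<otimes>\<^bsub>?R\<^esub> h" for f g h
      by (auto simp: int_group_ring_def fun_eq_iff distrib_right sum.distrib)
  qed
qed

(* A subset A of G is identified with the element indicator A of Z[G], and [c] \<cdot> f is the
   integer multiple c f. *)
definition partial_sum_family ::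
  "('a, 'b) monoid_scheme \<Rightarrow> nat \<Rightarrow> nat \<Rightarrow> nat \<Rightarrow> int \<Rightarrow> int \<Rightarrow> int \<Rightarrow> (nat \<Rightarrow> nat \<Rightarrow> 'a set) \<Rightarrow> bool"
where
  "partial_sum_family G m n k lam mu t S \<longleftrightarrow>
    comm_group G \<and> finite (carrier G) \<and> order G = n \<and>
    (\<forall>i<m. \<forall>j<m. S i j \<subseteq> carrier G) \<and>
    (\<forall>i<m. \<one>\<^bsub>G\<^esub> \<notin> S i i) \<and>
    (\<forall>i<m. (\<Sum>j<m. card (S i j)) = k \<and> (\<Sum>j<m. card (S j i)) = k) \<and>
    (let R = int_group_ring G; \<beta> = lam - mu; \<gamma> = t - mu in
      \<forall>i<m. \<forall>j<m.
        (\<Oplus>\<^bsub>R\<^esub>l\<in>{..<m}. indicator (S l j) \<otimes>\<^bsub>R\<^esub> indicator (S i l)) =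
        ([mu] \<cdot>\<^bsub>R\<^esub> indicator (carrier G) \<oplus>\<^bsub>R\<^esub> [\<beta>] \<cdot>\<^bsub>R\<^esub> indicator (S i j))
          \<oplus>\<^bsub>R\<^esub> [(if i = j then \<gamma> else 0)] \<cdot>\<^bsub>R\<^esub> \<one>\<^bsub>R\<^esub>)"

(* The partition condition is about the indexed family of diagonal sets: distinct indices
   have disjoint, nonempty sets, which partition_on alone (applied to the set of the sets S i i)
   would not express. *)
definition uniform_partial_sum_family ::
  "('a, 'b) monoid_scheme \<Rightarrow> nat \<Rightarrow> nat \<Rightarrow> nat \<Rightarrow> int \<Rightarrow> int \<Rightarrow> int \<Rightarrow> (nat \<Rightarrow> nat \<Rightarrow> 'a set) \<Rightarrow> bool"
where
  "uniform_partial_sum_family G m n k lam mu t S \<longleftrightarrow>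
    partial_sum_family G m n k lam mu t S \<and>
    (\<forall>i<m. \<forall>i'<m. card (S i i) = card (S i' i')) \<and>
    (\<forall>i<m. \<forall>j<m. \<forall>i'<m. \<forall>j'<m. i \<noteq> j \<and> i' \<noteq> j' \<longrightarrow> card (S i j) = card (S i' j')) \<and>
    disjoint_family_on (\<lambda>i. S i i) {..<m} \<and>
    partition_on (carrier G - {\<one>\<^bsub>G\<^esub>}) ((\<lambda>i. S i i) ` {..<m})"

end

theory Submission
  imports Defs "HOL-Number_Theory.Residues"
begin

text \<open>Let \<open>q = p\<^sup>d\<close> and \<open>G = F\<times>F\<close> for the field \<open>F\<close> of order \<open>q\<close>. Its \<open>q + 1\<close> lines through the origin
  are subgroups of order \<open>q\<close> that meet pairwise trivially; split them into \<open>z1\<close> classes of \<open>w\<close> lines.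
  Let \<open>S i i\<close> be the union of the lines of class \<open>i\<close> without the identity and, for \<open>i \<noteq> j\<close>, let
  \<open>S i j\<close> be a union of \<open>z2\<close> cosets of one line of class \<open>j\<close>. In the group ring, cosets of two
  different lines multiply to \<open>G\<close>, and \<open>L * C = q C\<close> for a coset \<open>C\<close> of the line \<open>L\<close>; expanding the
  products \<open>S l j * S i l\<close> with these two rules gives all the required equations, the off-diagonal
  ones by \<open>(w - z2)\<^sup>2 = w - z2\<close>.\<close>

section \<open>Finite fields of prime power order\<close>

context cring
begin

text \<open>Multiplying the expansion for \<open>n\<close> by \<open>x \<oplus> y\<close> gives two
  sums; after an index shift in the first one, Pascal's rule merges them.\<close>

lemma binomial_finsum:
  assumes x: "x \<in> carrier R" and y: "y \<in> carrier R"
  shows "(x \<oplus> y) [^] n = (\<Oplus>k\<in>{..n}. [(n choose k)] \<cdot> (x [^] k \<otimes> y [^] (n - k)))"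
proof (induction n)
  case 0
  show ?case by simp
next
  case (Suc n)
  let ?f = "\<lambda>k. [(n choose k)] \<cdot> (x [^] k \<otimes> y [^] (n - k))"
  let ?g = "\<lambda>k. [(n choose k)] \<cdot> (x [^] k \<otimes> y [^] (Suc n - k))"
  let ?h = "\<lambda>k. [(Suc n choose k)] \<cdot> (x [^] k \<otimes> y [^] (Suc n - k))"
  have f: "?f \<in> {..n} \<rightarrow> carrier R" and g: "?g \<in> UNIV \<rightarrow> carrier R" and h: "?h \<in> UNIV \<rightarrow> carrier R"
    using x y by auto
  have fx: "?f k \<otimes> x = [(n choose k)] \<cdot> (x [^] Suc k \<otimes> y [^] (n - k))" for k
  proof -
    have "?f k \<otimes> x = [(n choose k)] \<cdot> (x [^] k \<otimes> y [^] (n - k) \<otimes> x)"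
      using x y by (simp add: add_pow_ldistr)
    then show ?thesis
      using x y by (simp add: m_ac)
  qed
  have fy: "?f k \<otimes> y = ?g k" if "k \<le> n" for k
    using x y that by (simp add: add_pow_ldistr m_assoc Suc_diff_le)
  have "finsum R ?h {..Suc n} = (\<Oplus>k\<in>{..n}. ?h (Suc k)) \<oplus> ?h 0"
    using h by (intro add.finprod_Suc2) auto
  also have "(\<Oplus>k\<in>{..n}. ?h (Suc k)) = (\<Oplus>k\<in>{..n}. ?f k \<otimes> x \<oplus> ?g (Suc k))"
    unfolding fx using x y by (intro add.finprod_cong') (auto simp: add.nat_pow_mult)
  also have "\<dots> = (\<Oplus>k\<in>{..n}. ?f k \<otimes> x) \<oplus> (\<Oplus>k\<in>{..n}. ?g (Suc k))"
    using x y by (intro add.finprod_multf) auto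
  also have "\<dots> \<oplus> ?h 0 = (\<Oplus>k\<in>{..n}. ?f k \<otimes> x) \<oplus> ((\<Oplus>k\<in>{..n}. ?g (Suc k)) \<oplus> ?g 0)"
    using x y by (simp add: a_assoc Pi_def)
  also have "(\<Oplus>k\<in>{..n}. ?g (Suc k)) \<oplus> ?g 0 = finsum R ?g {..Suc n}"
    using g by (intro add.finprod_Suc2[symmetric]) auto
  \<comment> \<open>The extra term at \<open>Suc n\<close> vanishes because its coefficient is
    \<open>n choose Suc n\<close>.\<close>
  also have "\<dots> = finsum R ?g {..n}"
    using x y by (subst add.finprod_Suc) (auto simp: Pi_def binomial_eq_0)
  also have "\<dots> = (\<Oplus>k\<in>{..n}. ?f k \<otimes> y)"
    using x y fy by (intro add.finprod_cong') auto
  also have "(\<Oplus>k\<in>{..n}. ?f k \<otimes> x) \<oplus> (\<Oplus>k\<in>{..n}. ?f k \<otimes> y) = (x \<oplus> y) [^] n \<otimes> (x \<oplus> y)"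
    unfolding Suc using x y f by (simp add: r_distr finsum_ldistr)
  finally show ?case by simp
qed

lemma add_pow_eq_zero_if_dvd:
  fixes p n :: nat
  assumes "[p] \<cdot> \<one> = \<zero>" and "p dvd n" and x: "x \<in> carrier R"
  shows "[n] \<cdot> x = \<zero>"
proof -
  have "[p] \<cdot> x = ([p] \<cdot> \<one>) \<otimes> x"
    using x by (simp add: add_pow_ldistr)
  then have "[p] \<cdot> x = \<zero>"
    using assms by simp
  moreover obtain m where "n = p * m"
    using assms by blast
  ultimately show ?thesis
    using x add.nat_pow_pow[of x m p] by (simp add: add.nat_pow_one)
qed

text \<open>\<open>p\<close> divides \<open>p choose k\<close> for \<open>0 < k < p\<close>, so only
  the two outer terms of the binomial expansion survive. The exponent \<open>p ^ d\<close> iterates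
  this \<open>d\<close> times.\<close>

lemma frobenius_add:
  fixes p d :: nat
  assumes p: "Factorial_Ring.prime p" and char: "[p] \<cdot> \<one> = \<zero>"
    and x: "x \<in> carrier R" and y: "y \<in> carrier R"
  shows "(x \<oplus> y) [^] (p ^ d) = x [^] (p ^ d) \<oplus> y [^] (p ^ d)"
proof (induction d)
  case 0
  show ?case using x y by (simp only: power_0 nat_pow_eone a_closed)
next
  case (Suc d)
  have *: "(u \<oplus> v) [^] p = u [^] p \<oplus> v [^] p" if u: "u \<in> carrier R" and v: "v \<in> carrier R" for u v
  proof -
    let ?f = "\<lambda>k. [(p choose k)] \<cdot> (u [^] k \<otimes> v [^] (p - k))"
    obtain m where m: "p = Suc m" using prime_gt_0_nat[OF p] gr0_implies_Suc by blast
    have "(u \<oplus> v) [^] p = finsum R ?f {..p}"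
      by (rule binomial_finsum[OF u v])
    also have "\<dots> = u [^] p \<oplus> finsum R ?f {..m}"
      unfolding m using u v by (subst add.finprod_Suc) auto
    also have "finsum R ?f {..m} = (\<Oplus>k\<in>{..m}. if 0 = k then v [^] p else \<zero>)"
    proof (rule add.finprod_cong')
      fix k assume "k \<in> {..m}"
      then show "?f k = (if 0 = k then v [^] p else \<zero>)"
        using u v p m by (auto intro!: add_pow_eq_zero_if_dvd[OF char] dvd_choose_prime)
    qed (use v in auto)
    also have "\<dots> = v [^] p"
      using v add.finprod_singleton[of 0 "{..m}" "\<lambda>_. v [^] p"] by simp
    finally show ?thesis .
  qed
  have "z [^] (p ^ Suc d) = (z [^] (p ^ d)) [^] p" if "z \<in> carrier R" for z
    using that by (simp add: nat_pow_pow mult.commute)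
  then show ?case
    using Suc x y * by simp
qed

text \<open>Additivity applied to \<open>\<ominus> x \<oplus> x = \<zero>\<close> treats
  \<open>p = 2\<close> and odd \<open>p\<close> alike.\<close>

lemma frobenius_minus:
  fixes p d :: nat
  assumes p: "Factorial_Ring.prime p" and char: "[p] \<cdot> \<one> = \<zero>" and x: "x \<in> carrier R"
  shows "(\<ominus> x) [^] (p ^ d) = \<ominus> (x [^] (p ^ d))"
proof -
  have "\<zero> = (\<ominus> x \<oplus> x) [^] (p ^ d)"
    using x prime_gt_0_nat[OF p] by (simp add: l_neg nat_pow_zero)
  also have "\<dots> = (\<ominus> x) [^] (p ^ d) \<oplus> x [^] (p ^ d)"
    using x by (intro frobenius_add[OF p char]) auto
  finally show ?thesis
    using x by (metis a_inv_closed minus_equality nat_pow_closed)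
qed

end

text \<open>Serves to compare \<open>X^q - X\<close> with \<open>(X^q - a) - (X - a)\<close> in the
  ring of polynomials.\<close>

lemma (in abelian_group) minus_minus_cancel:
  assumes "x \<in> carrier G" "y \<in> carrier G" "z \<in> carrier G"
  shows "(x \<ominus> z) \<ominus> (y \<ominus> z) = x \<ominus> y"
proof -
  have "(x \<ominus> z) \<ominus> (y \<ominus> z) = x \<oplus> (\<ominus> z \<oplus> (z \<oplus> \<ominus> y))"
    using assms by (simp add: a_minus_def minus_add a_ac)
  then show ?thesis
    using assms by (simp add: r_neg1 a_minus_def)
qed

text \<open>Carries the equation \<open>[p] \<cdot> \<one> = \<zero>\<close> from the prime field to
  its algebraic closure and from a ring to its polynomials.\<close>

lemma (in ring_hom_ring) hom_add_pow:
  fixes n :: nat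
  assumes "x \<in> carrier R"
  shows "h ([n] \<cdot>\<^bsub>R\<^esub> x) = [n] \<cdot>\<^bsub>S\<^esub> h x"
  using assms by (induction n) auto

text \<open>Closure under sums and negation is additivity of Frobenius. For a fixed nonzero
  \<open>k\<close>, the power \<open>inv k [^] (p ^ d)\<close> is an inverse of
  \<open>k [^] (p ^ d) = k\<close>, hence equal to \<open>inv k\<close>.\<close>

lemma (in field) subfield_frobenius_fixed:
  fixes p d :: nat
  assumes p: "Factorial_Ring.prime p" and char: "[p] \<cdot> \<one> = \<zero>"
  shows "subfield {x \<in> carrier R. x [^] (p ^ d) = x} R"
proof (rule subfieldI')
  show "subring {x \<in> carrier R. x [^] (p ^ d) = x} R"
    by (rule subringI)
      (auto simp: frobenius_add[OF p char] frobenius_minus[OF p char] nat_pow_distrib)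
  fix k assume "k \<in> {x \<in> carrier R. x [^] (p ^ d) = x} - {\<zero>}"
  then have k: "k \<in> Units R" "k \<in> carrier R" "k [^] (p ^ d) = k"
    using field_Units by auto
  then have "inv k [^] (p ^ d) \<otimes> k = (inv k \<otimes> k) [^] (p ^ d)"
    by (simp only: nat_pow_distrib Units_inv_closed)
  also have "\<dots> = \<one>"
    using k by (simp add: nat_pow_one)
  finally have "inv k [^] (p ^ d) = inv k"
    using k by (metis Units_inv_closed inv_equality nat_pow_closed inv_char m_comm comm_inv_char)
  then show "inv k \<in> {x \<in> carrier R. x [^] (p ^ d) = x}"
    using k by auto
qed

section \<open>The polynomial X^q - X and its roots\<close>

lemma (in domain) degree_var_pow_minus_var:
  assumes "q > 1"
  shows "degree (X [^]\<^bsub>poly_ring R\<^esub> (q :: nat) \<ominus>\<^bsub>poly_ring R\<^esub> X) = q"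
proof -
  interpret UP: domain "poly_ring R"
    using univ_poly_is_domain[OF carrier_is_subring] .
  have X: "X \<in> carrier (poly_ring R)" and Xq: "X [^]\<^bsub>poly_ring R\<^esub> q \<in> carrier (poly_ring R)"
    using var_closed(1)[OF carrier_is_subring] by auto
  have pow: "X [^]\<^bsub>poly_ring R\<^esub> q = monom \<one> q"
    using unitary_monom_eq_var_pow[OF carrier_is_subring] by simp
  have deg: "degree (monom \<one> q) = q"
    by (simp add: monom_def)
  have degm: "degree (\<ominus>\<^bsub>poly_ring R\<^esub> X) = 1"
    using univ_poly_a_inv_degree[OF carrier_is_subring X] by (simp add: var_def)
  have "polynomial (carrier R) (monom \<one> q)" "polynomial (carrier R) (\<ominus>\<^bsub>poly_ring R\<^esub> X)"
    using Xq X UP.a_inv_closed[OF X] unfolding pow univ_poly_carrier by auto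
  \<comment> \<open>The summands have the different degrees \<open>q > 1\<close> and 1, so the
    leading term cannot cancel.\<close>
  then have "degree (poly_add (monom \<one> q) (\<ominus>\<^bsub>poly_ring R\<^esub> X)) = max q 1"
    using poly_add_degree_eq[OF carrier_is_subring, of "monom \<one> q" "\<ominus>\<^bsub>poly_ring R\<^esub> X"] assms
    unfolding deg degm by auto
  then show ?thesis
    using assms unfolding a_minus_def pow univ_poly_add by simp
qed

lemma (in domain) eval_var_pow_minus_var:
  assumes x: "x \<in> carrier R"
  shows "eval (X [^]\<^bsub>poly_ring R\<^esub> (q :: nat) \<ominus>\<^bsub>poly_ring R\<^esub> X) x = x [^] q \<ominus> x"
proof -
  interpret ev: ring_hom_ring "poly_ring R" R "\<lambda>p. eval p x"
    using eval_ring_hom[OF carrier_is_subring x] .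
  have X: "X \<in> carrier (poly_ring R)"
    using var_closed(1)[OF carrier_is_subring] .
  show ?thesis
    using X x by (simp add: a_minus_def ev.hom_nat_pow eval_var)
qed

text \<open>With \<open>Y = X - a\<close>, the Frobenius identity turns \<open>X\<^sup>q - X\<close> into \<open>Y\<^sup>q - Y\<close>, which \<open>Y\<^sup>2\<close>
  does not divide; hence all roots of \<open>X\<^sup>q - X\<close> are simple.\<close>

lemma (in domain) alg_mult_var_pow_minus_var_le_1:
  fixes p d :: nat
  assumes p: "Factorial_Ring.prime p" and "d > 0" and char: "[p] \<cdot> \<one> = \<zero>"
    and a: "a \<in> carrier R" "a [^] (p ^ d) = a"
  shows "alg_mult (X [^]\<^bsub>poly_ring R\<^esub> (p ^ d) \<ominus>\<^bsub>poly_ring R\<^esub> X) a \<le> 1"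
proof (rule ccontr)
  let ?U = "poly_ring R"
  let ?q = "p ^ d"
  let ?P = "X [^]\<^bsub>?U\<^esub> ?q \<ominus>\<^bsub>?U\<^esub> X"
  let ?Y = "[\<one>, \<ominus> a]"
  let ?c = "poly_of_const a"
  interpret UP: domain ?U
    using univ_poly_is_domain[OF carrier_is_subring] .
  interpret C: ring_hom_ring R ?U poly_of_const
    using canonical_embedding_ring_hom[OF carrier_is_subring] by simp
  interpret ev: ring_hom_ring ?U R "\<lambda>p. eval p a"
    using eval_ring_hom[OF carrier_is_subring a(1)] .
  assume "\<not> alg_mult ?P a \<le> 1"
  then have "2 \<le> alg_mult ?P a" by simp
  have X: "X \<in> carrier ?U"
    using var_closed(1)[OF carrier_is_subring] .
  have Y: "?Y \<in> carrier ?U"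
    using a(1) unfolding sym[OF univ_poly_carrier] polynomial_def by auto
  have c: "?c \<in> carrier ?U"
    using a(1) by (rule C.hom_closed)
  have YX: "?Y = X \<ominus>\<^bsub>?U\<^esub> ?c"
  proof -
    have "\<ominus>\<^bsub>?U\<^esub> ?c = poly_of_const (\<ominus> a)"
      using a(1) by simp
    then show ?thesis
      using a(1) unfolding a_minus_def univ_poly_add
      by (auto simp: var_def poly_of_const_def)
  qed
  have charU: "[p] \<cdot>\<^bsub>?U\<^esub> \<one>\<^bsub>?U\<^esub> = \<zero>\<^bsub>?U\<^esub>"
    using C.hom_add_pow[of \<one> p] char by simp
  have cq: "?c [^]\<^bsub>?U\<^esub> ?q = ?c"
    using C.hom_nat_pow[OF a(1), of ?q] a by simp
  \<comment> \<open>Frobenius expands the power of \<open>X - a\<close>, and the constant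
    \<open>a\<close> is fixed by it.\<close>
  have "?Y [^]\<^bsub>?U\<^esub> ?q = X [^]\<^bsub>?U\<^esub> ?q \<ominus>\<^bsub>?U\<^esub> ?c"
    unfolding YX a_minus_def
    using X c by (simp add: UP.frobenius_add[OF p charU] UP.frobenius_minus[OF p charU] cq)
  then have P: "?P = ?Y [^]\<^bsub>?U\<^esub> ?q \<ominus>\<^bsub>?U\<^esub> ?Y"
    using X c UP.nat_pow_closed[OF X, of ?q] unfolding YX by (simp add: UP.minus_minus_cancel)
  \<comment> \<open>Since \<open>?q\<close> is at least 2, another factor \<open>?Y\<close> remains
    after one has been split off from its \<open>?q\<close>-th power.\<close>
  obtain r where r: "?q = Suc (Suc r)"
    using prime_gt_1_nat[OF p] \<open>d > 0\<close>
    by (metis One_nat_def Suc_lessD less_imp_Suc_add one_less_power add_Suc plus_1_eq_Suc)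
  have "?Y [^]\<^bsub>?U\<^esub> (2::nat) divides\<^bsub>?U\<^esub> ?P"
    using le_alg_mult_imp_pdivides[OF a(1) _ \<open>2 \<le> alg_mult ?P a\<close>] X unfolding pdivides_def by auto
  then obtain g where g: "g \<in> carrier ?U" "?P = ?Y [^]\<^bsub>?U\<^esub> (2::nat) \<otimes>\<^bsub>?U\<^esub> g"
    by auto
  have "?Y \<otimes>\<^bsub>?U\<^esub> (?Y \<otimes>\<^bsub>?U\<^esub> g) = ?Y [^]\<^bsub>?U\<^esub> ?q \<ominus>\<^bsub>?U\<^esub> ?Y"
    using g Y unfolding P by (simp add: numeral_2_eq_2 UP.m_assoc)
  also have "\<dots> = ?Y \<otimes>\<^bsub>?U\<^esub> (?Y \<otimes>\<^bsub>?U\<^esub> ?Y [^]\<^bsub>?U\<^esub> r \<ominus>\<^bsub>?U\<^esub> \<one>\<^bsub>?U\<^esub>)"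
    using Y unfolding r a_minus_def by (simp add: UP.r_distr UP.r_minus UP.m_ac)
  \<comment> \<open>One factor \<open>?Y\<close> is cancelled in the domain of polynomials.
    Evaluation at its root \<open>a\<close> then leaves
    \<open>\<zero> = \<ominus> \<one>\<close>.\<close>
  finally have "?Y \<otimes>\<^bsub>?U\<^esub> g = ?Y \<otimes>\<^bsub>?U\<^esub> ?Y [^]\<^bsub>?U\<^esub> r \<ominus>\<^bsub>?U\<^esub> \<one>\<^bsub>?U\<^esub>"
    using Y g by (subst (asm) UP.m_lcancel) (auto simp: univ_poly_zero)
  then have "eval (?Y \<otimes>\<^bsub>?U\<^esub> g) a = eval (?Y \<otimes>\<^bsub>?U\<^esub> ?Y [^]\<^bsub>?U\<^esub> r \<ominus>\<^bsub>?U\<^esub> \<one>\<^bsub>?U\<^esub>) a"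
    by simp
  moreover have "eval ?Y a = \<zero>"
    using a(1) by (simp add: r_neg)
  ultimately have "\<zero> = \<ominus> \<one>"
    using Y g ev.hom_closed by (simp add: a_minus_def del: eval.simps)
  then show False
    using one_not_zero by (metis minus_minus minus_zero one_closed)
qed

text \<open>The fixed points are the roots of X^q - X. A split polynomial has as many roots with
  multiplicity as its degree, and here every multiplicity is 1.\<close>

lemma (in field) card_frobenius_fixed:
  fixes p d :: nat
  assumes p: "Factorial_Ring.prime p" and "d > 0" and char: "[p] \<cdot> \<one> = \<zero>"
    and splitted: "splitted (X [^]\<^bsub>poly_ring R\<^esub> (p ^ d) \<ominus>\<^bsub>poly_ring R\<^esub> X)"
  shows "card {x \<in> carrier R. x [^] (p ^ d) = x} = p ^ d"
proof -
  let ?U = "poly_ring R"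
  let ?P = "X [^]\<^bsub>?U\<^esub> (p ^ d) \<ominus>\<^bsub>?U\<^esub> X"
  let ?F = "{x \<in> carrier R. x [^] (p ^ d) = x}"
  interpret UP: domain ?U
    using univ_poly_is_domain[OF carrier_is_subring] .
  have q: "p ^ d > 1"
    using prime_gt_1_nat[OF p] \<open>d > 0\<close> by (rule one_less_power)
  have P: "?P \<in> carrier ?U"
    using var_closed(1)[OF carrier_is_subring] by auto
  have deg: "degree ?P = p ^ d"
    using degree_var_pow_minus_var[OF q] .
  \<comment> \<open>\<open>is_root\<close> excludes the zero polynomial, which is the list
    \<open>[]\<close>.\<close>
  have "?P \<noteq> []"
  proof
    assume "?P = []"
    then have "degree ?P = 0" by simp
    with deg q show False by linarith
  qed
  then have root: "is_root ?P x \<longleftrightarrow> x \<in> ?F" for x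
    unfolding is_root_def by (auto simp: eval_var_pow_minus_var)
  have set: "set_mset (roots ?P) = ?F"
    using root roots_mem_iff_is_root[OF P] by blast
  have "count (roots ?P) x = 1" if "x \<in> ?F" for x
  proof -
    have "count (roots ?P) x \<le> 1"
      unfolding alg_mult_eq_count_roots[OF P, symmetric]
      using that by (intro alg_mult_var_pow_minus_var_le_1[OF p \<open>d > 0\<close> char]) auto
    moreover have "count (roots ?P) x > 0"
      using that set by auto
    ultimately show ?thesis by linarith
  qed
  then have "size (roots ?P) = card ?F"
    by (simp add: size_multiset_overloaded_eq set)
  then show ?thesis
    using splitted deg unfolding splitted_def by simp
qed

text \<open>The field consists of the fixed points of \<open>x \<mapsto> x^q\<close>, with
  \<open>q = p ^ d\<close>, in an algebraic closure of the integers modulo \<open>p\<close>. Its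
  element type is the one in which \<open>exists_closure\<close> builds that closure.\<close>

lemma exists_field_of_prime_power_order:
  fixes p d :: nat
  assumes p: "Factorial_Ring.prime p" and "d > 0"
  obtains F :: "((int list \<times> nat) multiset \<Rightarrow> int) ring"
  where "field F" "card (carrier F) = p ^ d"
proof -
  define R where "R = residue_ring (int p)"
  interpret R: residues_prime p R
    by unfold_locales (fact p, rule eq_reflection[OF R_def])
  interpret R: field R
    by (rule R.is_field)
  obtain L :: "((int list \<times> nat) multiset \<Rightarrow> int) ring"
    where L: "algebraic_closure L (R.indexed_const ` carrier R)"
    and hom: "R.indexed_const \<in> ring_hom R L"
    by (rule R.exists_closure)
  interpret L: algebraic_closure L "R.indexed_const ` carrier R"
    by (fact L)
  interpret h: ring_hom_ring R L "R.indexed_const"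
    using hom by (intro ring_hom_ringI2) unfold_locales
  have "[n] \<cdot>\<^bsub>R\<^esub> \<one>\<^bsub>R\<^esub> = int n mod int p" for n :: nat
  proof (induction n)
    case (Suc n)
    then show ?case
      by (simp add: R.res_one_eq R.res_add_eq mod_simps add.commute)
  qed (simp add: R.res_zero_eq)
  then have "[p] \<cdot>\<^bsub>R\<^esub> \<one>\<^bsub>R\<^esub> = \<zero>\<^bsub>R\<^esub>"
    by (simp add: R.res_zero_eq)
  then have char: "[p] \<cdot>\<^bsub>L\<^esub> \<one>\<^bsub>L\<^esub> = \<zero>\<^bsub>L\<^esub>"
    using h.hom_add_pow[of "\<one>\<^bsub>R\<^esub>" p] by simp
  let ?K = "R.indexed_const ` carrier R"
  let ?F = "{x \<in> carrier L. x [^]\<^bsub>L\<^esub> (p ^ d) = x}"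
  show thesis
  proof
    show "field (L\<lparr>carrier := ?F\<rparr>)"
      using L.subfield_iff(2) L.subfield_frobenius_fixed[OF p char] by blast
    have sub: "subring ?K L"
      using L.subfield_axioms by (rule subfieldE(1))
    interpret UK: domain "?K[X]\<^bsub>L\<^esub>"
      using L.univ_poly_is_domain[OF sub] .
    have X: "X\<^bsub>L\<^esub> \<in> carrier (?K[X]\<^bsub>L\<^esub>)"
      using L.var_closed(1)[OF sub] .
    \<comment> \<open>The coefficients lie in the image \<open>?K\<close> of the prime field, so the
      polynomial splits in its algebraic closure \<open>L\<close>. The next step identifies it with
      the same polynomial over all of \<open>L\<close>.\<close>
    have "L.splitted (X\<^bsub>L\<^esub> [^]\<^bsub>?K[X]\<^bsub>L\<^esub>\<^esub> (p ^ d) \<ominus>\<^bsub>?K[X]\<^bsub>L\<^esub>\<^esub> X\<^bsub>L\<^esub>)"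
      using X by (intro L.roots_over_subfield) auto
    also have "X\<^bsub>L\<^esub> [^]\<^bsub>?K[X]\<^bsub>L\<^esub>\<^esub> (p ^ d) \<ominus>\<^bsub>?K[X]\<^bsub>L\<^esub>\<^esub> X\<^bsub>L\<^esub> = X\<^bsub>L\<^esub> [^]\<^bsub>poly_ring L\<^esub> (p ^ d) \<ominus>\<^bsub>poly_ring L\<^esub> X\<^bsub>L\<^esub>"
      using L.univ_poly_a_minus_consistent[OF sub X]
        L.unitary_monom_eq_var_pow[OF sub] L.unitary_monom_eq_var_pow[OF L.carrier_is_subring]
      by simp
    finally show "card (carrier (L\<lparr>carrier := ?F\<rparr>)) = p ^ d"
      using L.card_frobenius_fixed[OF p \<open>d > 0\<close> char] by simp
  qed
qed

section \<open>Convolution on a finite abelian group\<close>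

lemma int_group_ring_zero: "\<zero>\<^bsub>int_group_ring G\<^esub> = (\<lambda>x. 0)"
  by (simp add: int_group_ring_def)

lemma int_group_ring_add: "f \<oplus>\<^bsub>int_group_ring G\<^esub> g = (\<lambda>x. f x + g x)"
  by (simp add: int_group_ring_def)

lemma int_group_ring_finsum:
  assumes "comm_group G" "finite (carrier G)" and "finite A" and "f \<in> A \<rightarrow> carrier (int_group_ring G)"
  shows "finsum (int_group_ring G) f A = (\<lambda>x. \<Sum>l\<in>A. f l x)"
proof -
  interpret cring "int_group_ring G"
    using assms(1,2) by (rule cring_int_group_ring)
  show ?thesis
    using assms(3,4)
  proof (induction A rule: finite_induct)
    case empty
    then show ?case by (simp add: int_group_ring_zero)
  next
    case (insert a A)
    then have "finsum (int_group_ring G) f (insert a A) = f a \<oplus>\<^bsub>int_group_ring G\<^esub> finsum (int_group_ring G) f A"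
      by (intro finsum_insert) auto
    with insert show ?case by (simp add: int_group_ring_add)
  qed
qed

lemma int_group_ring_add_pow:
  fixes n :: int
  assumes "comm_group G" "finite (carrier G)" and f: "f \<in> carrier (int_group_ring G)"
  shows "[n] \<cdot>\<^bsub>int_group_ring G\<^esub> f = (\<lambda>x. n * f x)"
proof -
  interpret cring "int_group_ring G"
    using assms(1,2) by (rule cring_int_group_ring)
  have nat: "[m] \<cdot>\<^bsub>int_group_ring G\<^esub> f = (\<lambda>x. int m * f x)" for m :: nat
    by (induction m) (auto simp: int_group_ring_zero int_group_ring_add algebra_simps)
  show ?thesis
  proof (cases "n \<ge> 0")
    case True
    then show ?thesis by (simp add: add_pow_int_ge nat)
  next
    case False
    let ?g = "\<lambda>x. int (nat (- n)) * f x"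
    have "\<ominus>\<^bsub>int_group_ring G\<^esub> ?g = (\<lambda>x. - ?g x)"
      using f by (intro minus_equality) (auto simp: int_group_ring_def)
    then show ?thesis
      using False by (simp add: add_pow_int_lt nat)
  qed
qed

text \<open>The product of \<open>int_group_ring G\<close> without the default value 0 off the
  carrier, so that bilinearity holds at every point with no side conditions.\<close>

definition (in group) conv :: "('a \<Rightarrow> int) \<Rightarrow> ('a \<Rightarrow> int) \<Rightarrow> 'a \<Rightarrow> int" where
  "conv f g x = (\<Sum>y\<in>carrier G. f y * g (inv y \<otimes> x))"

lemma (in group) int_group_ring_mult:
  "f \<otimes>\<^bsub>int_group_ring G\<^esub> g = (\<lambda>x. if x \<in> carrier G then conv f g x else 0)"
  by (simp add: int_group_ring_def conv_def fun_eq_iff)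

lemma (in comm_group) conv_commute:
  assumes "finite (carrier G)" "f \<in> carrier (int_group_ring G)" "g \<in> carrier (int_group_ring G)" "x \<in> carrier G"
  shows "conv f g x = conv g f x"
proof -
  interpret cring "int_group_ring G"
    using comm_group_axioms assms(1) by (rule cring_int_group_ring)
  show ?thesis
    using m_comm[OF assms(2,3)] assms(4) by (metis int_group_ring_mult)
qed

lemma (in group) indicator_mem_int_group_ring:
  "A \<subseteq> carrier G \<Longrightarrow> indicator A \<in> carrier (int_group_ring G)"
  by (auto simp: int_group_ring_def indicator_def)

lemma (in group) conv_sum_left: "conv (\<lambda>y. \<Sum>a\<in>A. f a y) g x = (\<Sum>a\<in>A. conv (f a) g x)"
  unfolding conv_def sum_distrib_right by (rule sum.swap)

lemma (in group) conv_sum_right: "conv f (\<lambda>y. \<Sum>a\<in>A. g a y) x = (\<Sum>a\<in>A. conv f (g a) x)"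
  unfolding conv_def sum_distrib_left by (rule sum.swap)

lemma (in group) conv_diff_left: "conv (\<lambda>y. f y - c * f' y) g x = conv f g x - c * conv f' g x"
  unfolding conv_def sum_distrib_left by (simp add: algebra_simps sum_subtractf)

lemma (in group) conv_diff_right: "conv f (\<lambda>y. g y - c * g' y) x = conv f g x - c * conv f g' x"
  unfolding conv_def sum_distrib_left by (simp add: algebra_simps sum_subtractf)

lemma (in group) conv_one_left:
  assumes "finite (carrier G)" "x \<in> carrier G"
  shows "conv (indicator {\<one>}) f x = f x"
proof -
  have "conv (indicator {\<one>}) f x = (\<Sum>y\<in>carrier G. if y = \<one> then f (inv y \<otimes> x) else 0)"
    unfolding conv_def by (intro sum.cong) (auto simp: indicator_def)
  then show ?thesis
    using assms by (simp add: sum.delta)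
qed

text \<open>For \<open>x\<close> in the group, this counts the factorisations of \<open>x\<close>
  into an element \<open>y\<close> of \<open>A\<close> and one of \<open>B\<close>, since
  \<open>y\<close> determines the second factor.\<close>

lemma (in group) conv_indicator:
  assumes "finite (carrier G)" "A \<subseteq> carrier G"
  shows "conv (indicator A) (indicator B) x = int (card {y \<in> A. inv y \<otimes> x \<in> B})"
proof -
  have "conv (indicator A) (indicator B) x = (\<Sum>y\<in>carrier G. if y \<in> A \<and> inv y \<otimes> x \<in> B then 1 else 0)"
    unfolding conv_def by (intro sum.cong) (auto simp: indicator_def)
  also have "\<dots> = int (card {y \<in> carrier G. y \<in> A \<and> inv y \<otimes> x \<in> B})"
    using assms by (simp add: sum.If_cases Int_def)
  also have "{y \<in> carrier G. y \<in> A \<and> inv y \<otimes> x \<in> B} = {y \<in> A. inv y \<otimes> x \<in> B}"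
    using assms by auto
  finally show ?thesis .
qed

section \<open>Products of cosets in an abelian group\<close>

lemma (in comm_group) inv_mult_mem_subgroup:
  assumes H: "subgroup H G" and C: "C \<in> rcosets H" and u: "u \<in> C" and v: "v \<in> C"
  shows "inv u \<otimes> v \<in> H"
proof -
  obtain a where a: "a \<in> carrier G" "C = H #> a"
    using C by (auto simp: RCOSETS_def)
  then obtain h k where hk: "h \<in> H" "k \<in> H" "u = h \<otimes> a" "v = k \<otimes> a"
    using u v by (auto simp: r_coset_def)
  then have hkc: "h \<in> carrier G" "k \<in> carrier G"
    using H by (auto dest: subgroup.mem_carrier)
  \<comment> \<open>For right cosets this quotient is a conjugate of
    \<open>inv h \<otimes> k\<close> by \<open>a\<close>; commutativity removes
    \<open>a\<close>.\<close>
  have "inv u \<otimes> v = inv h \<otimes> k \<otimes> (inv a \<otimes> a)"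
    unfolding hk using hkc a by (simp only: inv_mult m_ac inv_closed m_closed)
  then show ?thesis
    using hk hkc a H by (simp add: subgroup.m_closed subgroup.m_inv_closed)
qed

lemma (in comm_group) subgroup_mult_mem_rcoset:
  assumes H: "subgroup H G" and C: "C \<in> rcosets H" and u: "u \<in> H" and v: "v \<in> C"
  shows "u \<otimes> v \<in> C"
proof -
  obtain a where a: "a \<in> carrier G" "C = H #> a"
    using C by (auto simp: RCOSETS_def)
  then obtain k where k: "k \<in> H" "v = k \<otimes> a"
    using v by (auto simp: r_coset_def)
  have "u \<otimes> v = (u \<otimes> k) \<otimes> a" "u \<otimes> k \<in> H"
    using k u a H by (auto simp: m_assoc subgroup.mem_carrier subgroup.m_closed)
  then show ?thesis
    using a by (auto simp: r_coset_def)
qed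

text \<open>Multiplication by an element of \<open>H\<close> preserves \<open>C\<close>, so the
  elements of \<open>H\<close> that are counted are all of them or none, according to whether
  \<open>x\<close> lies in \<open>C\<close>.\<close>

lemma (in comm_group) conv_subgroup_rcoset:
  assumes fin: "finite (carrier G)" and H: "subgroup H G" and C: "C \<in> rcosets H" and x: "x \<in> carrier G"
  shows "conv (indicator H) (indicator C) x = int (card H) * indicator C x"
proof -
  have HG: "H \<subseteq> carrier G" using H by (rule subgroup.subset)
  have "{y \<in> H. inv y \<otimes> x \<in> C} = (if x \<in> C then H else {})"
  proof -
    have "inv y \<otimes> x \<in> C \<longleftrightarrow> x \<in> C" if y: "y \<in> H" for y
    proof
      assume "inv y \<otimes> x \<in> C"
      from subgroup_mult_mem_rcoset[OF H C y this] show "x \<in> C"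
        using y HG x by (auto simp flip: m_assoc)
    next
      assume "x \<in> C"
      then show "inv y \<otimes> x \<in> C"
        using subgroup_mult_mem_rcoset[OF H C] y H by (simp add: subgroup.m_inv_closed)
    qed
    then show ?thesis by auto
  qed
  then show ?thesis
    unfolding conv_indicator[OF fin HG] by simp
qed

text \<open>Complementary subgroups: \<open>(y, z) \<mapsto> y z\<close> is a bijection from \<open>C \<times> D\<close> onto the group.\<close>

lemma (in comm_group) conv_complementary_rcosets:
  assumes fin: "finite (carrier G)" and H: "subgroup H G" and K: "subgroup K G"
    and HK: "H \<inter> K = {\<one>}" and card: "card H * card K = order G"
    and C: "C \<in> rcosets H" and D: "D \<in> rcosets K" and x: "x \<in> carrier G"
  shows "conv (indicator C) (indicator D) x = 1"
proof -
  have CG: "C \<subseteq> carrier G" and DG: "D \<subseteq> carrier G"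
    using C D H K by (auto dest: subgroup.rcosets_carrier[OF _ group_axioms])
  have inj: "inj_on (\<lambda>(y, z). y \<otimes> z) (C \<times> D)"
  proof (rule inj_onI, clarsimp)
    fix y z y' z' assume *: "y \<in> C" "z \<in> D" "y' \<in> C" "z' \<in> D" "y \<otimes> z = y' \<otimes> z'"
    then have c: "y \<in> carrier G" "z \<in> carrier G" "y' \<in> carrier G" "z' \<in> carrier G"
      using CG DG by auto
    \<comment> \<open>The two quotients coincide, one lying in \<open>H\<close> and the other in
      \<open>K\<close>, so both are trivial.\<close>
    have "inv y' \<otimes> y = inv y' \<otimes> (y \<otimes> z) \<otimes> inv z"
      using c by (simp add: m_assoc)
    also have "\<dots> = (inv y' \<otimes> y') \<otimes> (inv z \<otimes> z')"
      unfolding *(5) using c by (simp only: m_ac inv_closed m_closed)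
    finally have eq: "inv y' \<otimes> y = inv z \<otimes> z'"
      using c by simp
    moreover have "inv y' \<otimes> y \<in> H" "inv z \<otimes> z' \<in> K"
      using inv_mult_mem_subgroup[OF H C] inv_mult_mem_subgroup[OF K D] * by auto
    ultimately have "inv y' \<otimes> y = \<one>" "inv z \<otimes> z' = \<one>"
      using HK by auto
    then show "y = y' \<and> z = z'"
      using c by (metis inv_equality inv_inv inv_closed)
  qed
  \<comment> \<open>Surjectivity comes from counting: the product set has
    \<open>card H * card K = order G\<close> elements.\<close>
  have "card ((\<lambda>(y, z). y \<otimes> z) ` (C \<times> D)) = card (carrier G)"
    using card_image[OF inj] card card_cartesian_product[of C D] card_rcosets_equal[OF C subgroup.subset[OF H]]
      card_rcosets_equal[OF D subgroup.subset[OF K]] by (simp add: order_def)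
  moreover have "(\<lambda>(y, z). y \<otimes> z) ` (C \<times> D) \<subseteq> carrier G"
    using CG DG by auto
  ultimately have "(\<lambda>(y, z). y \<otimes> z) ` (C \<times> D) = carrier G"
    using fin by (simp add: card_subset_eq)
  then have "x \<in> (\<lambda>(y, z). y \<otimes> z) ` (C \<times> D)"
    using x by simp
  then obtain y z where yz: "y \<in> C" "z \<in> D" "x = y \<otimes> z"
    by auto
  have "{y \<in> C. inv y \<otimes> x \<in> D} = {y}"
  proof (intro equalityI subsetI; clarsimp)
    fix y' assume y': "y' \<in> C" "inv y' \<otimes> x \<in> D"
    have "y' \<otimes> (inv y' \<otimes> x) = y \<otimes> z"
      using y' x CG yz(3) by (auto simp flip: m_assoc)
    then show "y' = y"
      using inj_onD[OF inj, of "(y', inv y' \<otimes> x)" "(y, z)"] y' yz by auto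
  next
    have "y \<in> carrier G" "z \<in> carrier G"
      using yz CG DG by auto
    then have "inv y \<otimes> x = z"
      unfolding yz(3) by (simp flip: m_assoc)
    then show "y \<in> C \<and> inv y \<otimes> x \<in> D"
      using yz by simp
  qed
  then show ?thesis
    unfolding conv_indicator[OF fin CG] by simp
qed

section \<open>Spreads\<close>

text \<open>An abstract form of the lines through the origin of a plane over a field of order
  \<open>q\<close>. The indices run up to and including \<open>q\<close>, so there are
  \<open>q + 1\<close> lines; that they cover the group follows by counting.\<close>

locale group_spread = comm_group G for G (structure) +
  fixes q :: nat and L :: "nat \<Rightarrow> 'a set"
  assumes q_gt_1: "q > 1" and order_eq: "order G = q\<^sup>2"
    and subgroup_line: "i \<le> q \<Longrightarrow> subgroup (L i) G"
    and card_line: "i \<le> q \<Longrightarrow> card (L i) = q"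
    and line_inter: "i \<le> q \<Longrightarrow> j \<le> q \<Longrightarrow> i \<noteq> j \<Longrightarrow> L i \<inter> L j = {\<one>}"
begin

lemma finite_carrier: "finite (carrier G)"
  using order_eq q_gt_1 by (intro order_gt_0_iff_finite[THEN iffD1]) simp

lemma line_subset: "i \<le> q \<Longrightarrow> L i \<subseteq> carrier G"
  using subgroup_line by (rule subgroup.subset)

lemma one_in_line: "i \<le> q \<Longrightarrow> \<one> \<in> L i"
  using subgroup_line by (rule subgroup.one_closed)

lemma finite_line: "i \<le> q \<Longrightarrow> finite (L i)"
  using line_subset finite_carrier finite_subset by blast

lemma card_line_minus_one: "i \<le> q \<Longrightarrow> card (L i - {\<one>}) = q - 1"
  by (simp add: card_Diff_singleton one_in_line card_line)

lemma disjoint_lines: "disjoint_family_on (\<lambda>i. L i - {\<one>}) {..q}"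
  using line_inter by (auto simp: disjoint_family_on_def)

lemma card_lines:
  assumes "A \<subseteq> {..q}"
  shows "card ((\<Union>a\<in>A. L a) - {\<one>}) = card A * (q - 1)"
proof -
  have "finite A"
    using assms finite_subset by blast
  have "(\<Union>a\<in>A. L a) - {\<one>} = (\<Union>a\<in>A. L a - {\<one>})"
    by auto
  also have "card \<dots> = (\<Sum>a\<in>A. card (L a - {\<one>}))"
    using assms \<open>finite A\<close> finite_line disjoint_lines
    by (intro card_UN_disjoint') (auto intro: disjoint_family_on_mono)
  also have "\<dots> = (\<Sum>a\<in>A. q - 1)"
    using assms by (intro sum.cong) (auto simp: card_line_minus_one)
  finally show ?thesis by simp
qed

text \<open>Without the identity the lines are disjoint and have \<open>(q + 1) * (q - 1)\<close>
  elements together, as many as the group has nonidentity elements.\<close>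

lemma lines_cover: "(\<Union>a\<le>q. L a) = carrier G"
proof -
  have "card ((\<Union>a\<le>q. L a) - {\<one>}) = (q + 1) * (q - 1)"
    using card_lines[of "{..q}"] by simp
  also have "\<dots> = card (carrier G - {\<one>})"
    using order_eq q_gt_1 finite_carrier
    by (simp add: order_def card_Diff_singleton power2_eq_square algebra_simps)
  finally have "(\<Union>a\<le>q. L a) - {\<one>} = carrier G - {\<one>}"
    using line_subset finite_carrier by (intro card_subset_eq) auto
  moreover have "\<one> \<in> (\<Union>a\<le>q. L a)"
    using one_in_line by auto
  ultimately show ?thesis
    by (metis insert_Diff one_closed)
qed

lemma line_in_rcosets: "i \<le> q \<Longrightarrow> L i \<in> rcosets (L i)"
  using subgroup.subgroup_in_rcosets[OF subgroup_line group_axioms] .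

lemma rcoset_subset: "i \<le> q \<Longrightarrow> C \<in> rcosets (L i) \<Longrightarrow> C \<subseteq> carrier G"
  using subgroup.rcosets_carrier[OF subgroup_line group_axioms] .

lemma card_rcosets_line: "i \<le> q \<Longrightarrow> card (rcosets (L i)) = q"
  using lagrange[OF subgroup_line, of i] card_line[of i] order_eq q_gt_1
  by (simp add: power2_eq_square)

lemma finite_rcosets_line: "i \<le> q \<Longrightarrow> finite (rcosets (L i))"
  using card_rcosets_line q_gt_1 by (metis card.infinite not_one_less_zero)

lemma card_rcoset: "i \<le> q \<Longrightarrow> C \<in> rcosets (L i) \<Longrightarrow> card C = q"
  using card_rcosets_equal[OF _ line_subset] card_line by metis

lemma card_Union_rcosets:
  assumes i: "i \<le> q" and V: "V \<subseteq> rcosets (L i)"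
  shows "card (\<Union>V) = card V * q"
proof -
  have "card (\<Union>V) = sum card V"
    using V i rcos_disjoint[OF subgroup_line[OF i]] finite_carrier rcoset_subset[OF i]
    by (intro card_Union_disjoint) (auto intro: pairwise_subset finite_subset)
  also have "\<dots> = (\<Sum>C\<in>V. q)"
    using V card_rcoset[OF i] by (intro sum.cong) auto
  finally show ?thesis by simp
qed

lemma indicator_Union_rcosets:
  assumes i: "i \<le> q" and V: "V \<subseteq> rcosets (L i)"
  shows "(indicator (\<Union>V) :: 'a \<Rightarrow> int) = (\<lambda>x. \<Sum>C\<in>V. indicator C x)"
proof
  fix x
  have fin: "finite V"
    using V finite_rcosets_line[OF i] finite_subset by blast
  have dis: "C = D" if "C \<in> V" "D \<in> V" "x \<in> C" "x \<in> D" for C D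
    using V that rcos_disjoint[OF subgroup_line[OF i]] unfolding pairwise_def disjnt_def by blast
  show "indicator (\<Union>V) x = (\<Sum>C\<in>V. indicator C x :: int)"
  proof (cases "x \<in> \<Union>V")
    case True
    then obtain C where C: "C \<in> V" "x \<in> C" by auto
    have "(\<Sum>D\<in>V. indicator D x :: int) = (\<Sum>D\<in>V. if D = C then 1 else 0)"
      using dis C by (intro sum.cong) (auto simp: indicator_def)
    then show ?thesis
      using True C fin by (simp add: sum.delta)
  next
    case False
    then show ?thesis by (simp add: indicator_def)
  qed
qed

text \<open>Away from the identity at most one of the lines contains \<open>x\<close>; the identity
  lies in all \<open>card A\<close> of them, which the last term corrects.\<close>

lemma indicator_lines:
  assumes A: "A \<subseteq> {..q}"
  shows "(indicator ((\<Union>a\<in>A. L a) - {\<one>}) :: 'a \<Rightarrow> int)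
    = (\<lambda>x. (\<Sum>a\<in>A. indicator (L a) x) - int (card A) * indicator {\<one>} x)"
proof
  fix x
  have fin: "finite A"
    using A finite_subset by blast
  show "indicator ((\<Union>a\<in>A. L a) - {\<one>}) x
    = (\<Sum>a\<in>A. indicator (L a) x) - int (card A) * indicator {\<one>} x"
  proof (cases "x = \<one>")
    case True
    have "(\<Sum>a\<in>A. indicator (L a) \<one> :: int) = (\<Sum>a\<in>A. 1)"
      using one_in_line A by (intro sum.cong) auto
    with True show ?thesis by simp
  next
    case x: False
    show ?thesis
    proof (cases "x \<in> (\<Union>a\<in>A. L a)")
      case True
      then obtain a where a: "a \<in> A" "x \<in> L a" by auto
      have "(\<Sum>b\<in>A. indicator (L b) x :: int) = (\<Sum>b\<in>A. if b = a then 1 else 0)"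
        using a A x line_inter by (intro sum.cong) (auto simp: indicator_def)
      then show ?thesis
        using True x a fin by (simp add: sum.delta)
    next
      case False
      with x show ?thesis by (simp add: indicator_def)
    qed
  qed
qed

section \<open>Products of lines and unions of cosets\<close>

lemma conv_distinct_rcosets:
  assumes "i \<le> q" "j \<le> q" "i \<noteq> j" "C \<in> rcosets (L i)" "D \<in> rcosets (L j)" "x \<in> carrier G"
  shows "conv (indicator C) (indicator D) x = 1"
  using assms
  by (intro conv_complementary_rcosets[OF finite_carrier subgroup_line subgroup_line, of i j])
    (simp_all add: line_inter card_line order_eq power2_eq_square)

lemma conv_line_rcoset:
  assumes "i \<le> q" "C \<in> rcosets (L i)" "x \<in> carrier G"
  shows "conv (indicator (L i)) (indicator C) x = int q * indicator C x"
  using conv_subgroup_rcoset[OF finite_carrier subgroup_line assms(2,3)] assms(1)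
  by (simp add: card_line)

lemma conv_line_Union_rcosets:
  assumes a: "a \<le> q" and i: "i \<le> q" and V: "V \<subseteq> rcosets (L i)" and x: "x \<in> carrier G"
  shows "conv (indicator (L a)) (indicator (\<Union>V)) x
    = (if a = i then int q * indicator (\<Union>V) x else int (card V))"
proof (cases "a = i")
  case True
  have "conv (indicator (L i)) (indicator (\<Union>V)) x = (\<Sum>C\<in>V. int q * indicator C x)"
    unfolding indicator_Union_rcosets[OF i V] conv_sum_right
    using V i x by (intro sum.cong) (auto simp: conv_line_rcoset)
  then show ?thesis
    using True unfolding indicator_Union_rcosets[OF i V] by (simp add: sum_distrib_left)
next
  case False
  have "conv (indicator (L a)) (indicator (\<Union>V)) x = (\<Sum>C\<in>V. 1)"
    unfolding indicator_Union_rcosets[OF i V] conv_sum_right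
    using V i x a False line_in_rcosets[OF a]
    by (intro sum.cong) (auto intro!: conv_distinct_rcosets[of a i])
  then show ?thesis
    using False by simp
qed

lemma conv_distinct_Union_rcosets:
  assumes i: "i \<le> q" and j: "j \<le> q" and "i \<noteq> j"
    and V: "V \<subseteq> rcosets (L i)" and W: "W \<subseteq> rcosets (L j)" and x: "x \<in> carrier G"
  shows "conv (indicator (\<Union>V)) (indicator (\<Union>W)) x = int (card V) * int (card W)"
proof -
  have "conv (indicator (\<Union>V)) (indicator (\<Union>W)) x = (\<Sum>C\<in>V. \<Sum>D\<in>W. 1)"
    unfolding indicator_Union_rcosets[OF i V] indicator_Union_rcosets[OF j W] conv_sum_left conv_sum_right
    using assms by (intro sum.cong) (auto intro!: conv_distinct_rcosets[of i j])
  then show ?thesis by simp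
qed

lemma conv_lines_Union_rcosets:
  assumes A: "A \<subseteq> {..q}" and i: "i \<le> q" and V: "V \<subseteq> rcosets (L i)" and x: "x \<in> carrier G"
  shows "conv (indicator ((\<Union>a\<in>A. L a) - {\<one>})) (indicator (\<Union>V)) x
    = (if i \<in> A then (int q - int (card A)) * indicator (\<Union>V) x + (int (card A) - 1) * int (card V)
       else int (card A) * int (card V) - int (card A) * indicator (\<Union>V) x)"
proof -
  have fin: "finite A"
    using A finite_subset by blast
  have "conv (indicator ((\<Union>a\<in>A. L a) - {\<one>})) (indicator (\<Union>V)) x
    = (\<Sum>a\<in>A. conv (indicator (L a)) (indicator (\<Union>V)) x) - int (card A) * indicator (\<Union>V) x"
    unfolding indicator_lines[OF A] conv_diff_left conv_sum_left
    by (simp add: conv_one_left[OF finite_carrier x])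
  \<comment> \<open>Each line is given the contribution \<open>card V\<close> of a line other than
    \<open>L i\<close>; the second summand corrects this at \<open>a = i\<close>.\<close>
  also have "(\<Sum>a\<in>A. conv (indicator (L a)) (indicator (\<Union>V)) x)
    = (\<Sum>a\<in>A. int (card V) + (if a = i then int q * indicator (\<Union>V) x - int (card V) else 0))"
    using A by (intro sum.cong) (auto simp: conv_line_Union_rcosets[OF _ i V x])
  also have "\<dots> = int (card A) * int (card V) + (if i \<in> A then int q * indicator (\<Union>V) x - int (card V) else 0)"
    using fin by (simp add: sum.distrib sum.delta)
  finally show ?thesis
    by (auto simp: algebra_simps)
qed

text \<open>Let \<open>D\<close> be the sum of \<open>n\<close> lines minus \<open>n\<close> times
  the identity. For a line \<open>M\<close> among them, the product of \<open>M\<close> and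
  \<open>D\<close> is \<open>(q - n) M + (n - 1) G\<close>. Summing over the lines and subtracting
  \<open>n D\<close> gives the claim once the sum of the lines is rewritten as \<open>D\<close> plus
  \<open>n\<close> times the identity.\<close>

lemma conv_lines_lines:
  assumes A: "A \<subseteq> {..q}" and x: "x \<in> carrier G"
  shows "conv (indicator ((\<Union>a\<in>A. L a) - {\<one>})) (indicator ((\<Union>a\<in>A. L a) - {\<one>})) x
    = (int (card A))\<^sup>2 - int (card A) + (int q - 2 * int (card A)) * indicator ((\<Union>a\<in>A. L a) - {\<one>}) x
      + int (card A) * (int q - int (card A)) * indicator {\<one>} x"
    (is "conv ?D ?D x = ?rhs")
proof -
  let ?n = "int (card A)"
  have fin: "finite A"
    using A finite_subset by blast
  have D: "?D = (\<lambda>x. (\<Sum>a\<in>A. indicator (L a) x) - ?n * indicator {\<one>} x)"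
    by (rule indicator_lines[OF A])
  have L: "conv (indicator (L b)) (indicator (L a)) x = (if a = b then int q * indicator (L b) x else 1)"
    if "a \<in> A" "b \<in> A" for a b
  proof -
    have "a \<le> q" "b \<le> q"
      using that A by auto
    \<comment> \<open>A line is the union of the singleton family consisting of one of its own
      cosets.\<close>
    then show ?thesis
      using conv_line_Union_rcosets[of b a "{L a}", OF _ _ _ x] line_in_rcosets[of a] by simp
  qed
  have LD: "conv (indicator (L b)) ?D x = (int q - ?n) * indicator (L b) x + ?n - 1" if b: "b \<in> A" for b
  proof -
    have "conv (indicator (L b)) (indicator {\<one>}) x = conv (indicator {\<one>}) (indicator (L b)) x"
      using b A line_subset x
      by (intro conv_commute[OF finite_carrier] indicator_mem_int_group_ring) auto
    then have one: "conv (indicator (L b)) (indicator {\<one>}) x = indicator (L b) x"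
      by (simp add: conv_one_left[OF finite_carrier x])
    have "conv (indicator (L b)) ?D x
      = (\<Sum>a\<in>A. conv (indicator (L b)) (indicator (L a)) x) - ?n * indicator (L b) x"
      unfolding D conv_diff_right conv_sum_right one ..
    also have "(\<Sum>a\<in>A. conv (indicator (L b)) (indicator (L a)) x)
      = (\<Sum>a\<in>A. 1 + (if a = b then int q * indicator (L b) x - 1 else 0))"
      using b by (intro sum.cong) (auto simp: L)
    also have "\<dots> = ?n + int q * indicator (L b) x - 1"
      using fin b by (simp add: sum.distrib sum.delta)
    finally show ?thesis
      by (simp add: algebra_simps)
  qed
  have "conv ?D ?D x = conv (\<lambda>x. (\<Sum>a\<in>A. indicator (L a) x) - ?n * indicator {\<one>} x) ?D x"
    unfolding D ..
  also have "\<dots> = (\<Sum>b\<in>A. conv (indicator (L b)) ?D x) - ?n * ?D x"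
    unfolding conv_diff_left conv_sum_left
    by (simp add: conv_one_left[OF finite_carrier x])
  also have "(\<Sum>b\<in>A. conv (indicator (L b)) ?D x)
    = (int q - ?n) * (\<Sum>b\<in>A. indicator (L b) x) + ?n * (?n - 1)"
    by (simp add: LD sum.distrib sum_distrib_left algebra_simps sum_subtractf)
  also have "(\<Sum>b\<in>A. indicator (L b) x) = ?D x + ?n * indicator {\<one>} x"
    using fun_cong[OF D, of x] by simp
  finally show ?thesis
    by (simp add: algebra_simps power2_eq_square)
qed

end

section \<open>The partial sum family of a spread\<close>

text \<open>Stated over a semiring to serve both the sizes, which are natural numbers, and the
  diagonal equations, which are over the integers.\<close>

lemma sum_const_except:
  fixes a b :: "'a :: comm_semiring_1"
  assumes "i < n"
  shows "(\<Sum>j<n. if j = i then a else b) = a + of_nat (n - 1) * b"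
proof -
  have "(\<Sum>j<n. if j = i then a else b) = a + (\<Sum>j\<in>{..<n} - {i}. if j = i then a else b)"
    using assms by (subst sum.remove[of _ i]) auto
  also have "(\<Sum>j\<in>{..<n} - {i}. if j = i then a else b) = (\<Sum>j\<in>{..<n} - {i}. b)"
    by (intro sum.cong) auto
  finally show ?thesis
    using assms by simp
qed

text \<open>\<open>U j\<close> consists of cosets of the line \<open>j * w\<close>, the first one of
  class \<open>j\<close>, and supplies all off-diagonal sets of column \<open>j\<close>. Its size is
  prescribed only if there are two distinct indices: for \<open>z1 = 1\<close> one has
  \<open>w = q + 1\<close>, and \<open>z2 = w\<close> would exceed the \<open>q\<close> cosets of a
  line.\<close>

locale spread_classes = group_spread +
  fixes w z1 z2 :: nat and U :: "nat \<Rightarrow> 'a set set"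
  assumes w_pos: "w > 0" and classes: "z1 * w = q + 1" and z2: "z2 \<in> {w - 1, w}"
    and U_subset: "j < z1 \<Longrightarrow> U j \<subseteq> rcosets (L (j * w))"
    and card_U: "i < z1 \<Longrightarrow> j < z1 \<Longrightarrow> i \<noteq> j \<Longrightarrow> card (U j) = z2"
begin

definition line_class :: "nat \<Rightarrow> nat set" where
  "line_class i = {i * w..<i * w + w}"

text \<open>Under a nontrivial character that is trivial on a line of class \<open>c\<close>, the matrix \<open>N = S + w I\<close>
  has only its column \<open>c\<close> nonzero, with diagonal entry \<open>q\<close>, and so satisfies \<open>N\<^sup>2 = q N\<close>.\<close>

definition family :: "nat \<Rightarrow> nat \<Rightarrow> 'a set" where
  "family i j = (if i = j then (\<Union>a\<in>line_class i. L a) - {\<one>} else \<Union>(U j))"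

lemma line_class_subset:
  assumes "i < z1"
  shows "line_class i \<subseteq> {..q}"
proof
  fix a assume "a \<in> line_class i"
  then have "a < (i + 1) * w"
    by (simp add: line_class_def)
  also have "\<dots> \<le> z1 * w"
    using assms by (intro mult_right_mono) auto
  finally show "a \<in> {..q}"
    using classes by simp
qed

lemma card_line_class: "card (line_class i) = w"
  by (simp add: line_class_def)

lemma mem_line_class: "a \<in> line_class i \<longleftrightarrow> a div w = i"
proof
  assume "a \<in> line_class i"
  then show "a div w = i"
    by (intro div_nat_eqI) (simp_all add: line_class_def mult.commute)
next
  assume "a div w = i"
  then show "a \<in> line_class i"
    using w_pos dividend_less_div_times[of w a] by (auto simp: line_class_def add.commute)
qed

lemma representative_mem_line_class: "j * w \<in> line_class i \<longleftrightarrow> i = j"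
  using w_pos by (auto simp: mem_line_class)

lemma representative_le: "j < z1 \<Longrightarrow> j * w \<le> q"
  using line_class_subset[of j] representative_mem_line_class[of j j] by auto

lemma z1_pos: "z1 > 0"
  using classes by (cases z1) auto

lemma union_line_classes: "(\<Union>i<z1. line_class i) = {..q}"
proof -
  have "a div w < z1" if "a \<le> q" for a
    using that classes by (intro less_mult_imp_div_less) simp
  then show ?thesis
    using line_class_subset by (auto simp: mem_line_class)
qed

section \<open>Sizes and pairwise products of the members\<close>

lemma family_subset:
  assumes i: "i < z1" and j: "j < z1"
  shows "family i j \<subseteq> carrier G"
proof -
  have "(\<Union>a\<in>line_class i. L a) \<subseteq> carrier G"
    using line_class_subset[OF i] line_subset by (intro UN_least) auto
  moreover have "\<Union>(U j) \<subseteq> carrier G"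
    using rcoset_subset[OF representative_le[OF j]] U_subset[OF j] by (intro Union_least) auto
  ultimately show ?thesis
    by (auto simp: family_def)
qed

lemma card_family_diag: "i < z1 \<Longrightarrow> card (family i i) = w * (q - 1)"
  using card_lines[OF line_class_subset] by (simp add: family_def card_line_class)

lemma card_family_off_diag: "i < z1 \<Longrightarrow> j < z1 \<Longrightarrow> i \<noteq> j \<Longrightarrow> card (family i j) = z2 * q"
  using card_Union_rcosets[OF representative_le U_subset] card_U by (simp add: family_def)

lemma sum_card_family:
  assumes i: "i < z1"
  shows "(\<Sum>j<z1. card (family i j)) = (q - 1) * w + (z1 - 1) * z2 * q"
    and "(\<Sum>j<z1. card (family j i)) = (q - 1) * w + (z1 - 1) * z2 * q"
proof -
  have "(\<Sum>j<z1. card (family i j)) = (\<Sum>j<z1. if j = i then w * (q - 1) else z2 * q)"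
    "(\<Sum>j<z1. card (family j i)) = (\<Sum>j<z1. if j = i then w * (q - 1) else z2 * q)"
    using i by (auto intro!: sum.cong simp: card_family_diag card_family_off_diag)
  then show "(\<Sum>j<z1. card (family i j)) = (q - 1) * w + (z1 - 1) * z2 * q"
    "(\<Sum>j<z1. card (family j i)) = (q - 1) * w + (z1 - 1) * z2 * q"
    using sum_const_except[OF i, of "w * (q - 1)" "z2 * q"] by (simp_all add: mult_ac)
qed

text \<open>The factors are \<open>\<Union>(U j)\<close> and \<open>\<Union>(U l)\<close>, made of
  \<open>z2\<close> cosets each of two different lines. The case distinction only selects an index
  distinct from \<open>j\<close>, through which the size of \<open>U j\<close> is known.\<close>

lemma conv_family_off_diag:
  assumes "i < z1" "j < z1" "l < z1" "l \<noteq> i" "l \<noteq> j" "x \<in> carrier G"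
  shows "conv (indicator (family l j)) (indicator (family i l)) x = (int z2)\<^sup>2"
proof (cases "i = j")
  case False
  then show ?thesis
    using assms w_pos card_U[of i j] card_U[of i l]
      conv_distinct_Union_rcosets[OF representative_le representative_le _ U_subset U_subset, of j l]
    by (simp add: family_def power2_eq_square)
next
  case True
  then show ?thesis
    using assms w_pos card_U[of l i] card_U[of i l]
      conv_distinct_Union_rcosets[OF representative_le representative_le _ U_subset U_subset, of j l]
    by (simp add: family_def power2_eq_square)
qed

lemma conv_family_diag:
  assumes "i < z1" "x \<in> carrier G"
  shows "conv (indicator (family i i)) (indicator (family i i)) x
    = (int w)\<^sup>2 - int w + (int q - 2 * int w) * indicator (family i i) x
      + int w * (int q - int w) * indicator {\<one>} x"
  using conv_lines_lines[OF line_class_subset] assms by (simp add: family_def card_line_class)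

text \<open>The line \<open>j * w\<close> belongs to class \<open>j\<close> and multiplies the union
  of its cosets by \<open>q\<close>; the other \<open>w - 1\<close> lines contribute the constant
  \<open>z2\<close> each, and the removed identities account for \<open>- w\<close>.\<close>

lemma conv_family_left_diag:
  assumes "i < z1" "j < z1" "i \<noteq> j" "x \<in> carrier G"
  shows "conv (indicator (family j j)) (indicator (family i j)) x
    = (int q - int w) * indicator (family i j) x + (int w - 1) * int z2"
  using assms conv_lines_Union_rcosets[OF line_class_subset representative_le U_subset, of j j] card_U[of i j]
  by (simp add: family_def card_line_class representative_mem_line_class)

text \<open>Class \<open>i\<close> does not contain the line \<open>j * w\<close>, so each of its
  \<open>w\<close> lines contributes the constant \<open>z2\<close>.\<close>

lemma conv_family_right_diag:
  assumes "i < z1" "j < z1" "i \<noteq> j" "x \<in> carrier G"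
  shows "conv (indicator (family i j)) (indicator (family i i)) x
    = int w * int z2 - int w * indicator (family i j) x"
proof -
  have "conv (indicator (family i j)) (indicator (family i i)) x
    = conv (indicator (family i i)) (indicator (family i j)) x"
    using assms
    by (intro conv_commute finite_carrier indicator_mem_int_group_ring family_subset)
  then show ?thesis
    using assms conv_lines_Union_rcosets[OF line_class_subset representative_le U_subset, of i j] card_U[of i j]
    by (simp add: family_def card_line_class representative_mem_line_class)
qed

lemma sum_conv_family:
  assumes i: "i < z1" and j: "j < z1" and x: "x \<in> carrier G"
  shows "(\<Sum>l<z1. conv (indicator (family l j)) (indicator (family i l)) x)
    = (int w)\<^sup>2 - int w + (int z1 - 1) * (int z2)\<^sup>2
      + (int q - 2 * int w) * indicator (family i j) x
      + (if i = j then int w * (int q - int w) * indicator {\<one>} x else 0)"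
proof (cases "i = j")
  case True
  have "(\<Sum>l<z1. conv (indicator (family l j)) (indicator (family i l)) x)
    = (\<Sum>l<z1. if l = i then conv (indicator (family i i)) (indicator (family i i)) x else (int z2)\<^sup>2)"
    using True i x by (intro sum.cong) (auto simp: conv_family_off_diag)
  then show ?thesis
    using True i x z1_pos unfolding sum_const_except[OF i]
    by (simp add: conv_family_diag of_nat_diff)
next
  case False
  let ?c = "\<lambda>l. conv (indicator (family l j)) (indicator (family i l)) x"
  \<comment> \<open>The terms with \<open>l = i\<close> and \<open>l = j\<close> involve a diagonal
    set; the other \<open>z1 - 2\<close> terms are equal constants.\<close>
  have "sum ?c {..<z1} = ?c i + (?c j + sum ?c ({..<z1} - {i} - {j}))"
    using i j False by (subst sum.remove[of _ i], simp, simp, subst sum.remove[of _ j]) auto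
  also have "sum ?c ({..<z1} - {i} - {j}) = (\<Sum>l\<in>{..<z1} - {i} - {j}. (int z2)\<^sup>2)"
    using i j x by (intro sum.cong) (auto simp: conv_family_off_diag)
  also have "\<dots> = (int z1 - 2) * (int z2)\<^sup>2"
    using i j False by (simp add: of_nat_diff)
  also have "?c j = (int q - int w) * indicator (family i j) x + (int w - 1) * int z2"
    using i j False x by (rule conv_family_left_diag)
  also have "?c i = int w * int z2 - int w * indicator (family i j) x"
    using i j x False by (intro conv_family_right_diag) auto
  finally have sum: "sum ?c {..<z1} = int w * int z2 - int w * indicator (family i j) x
    + ((int q - int w) * indicator (family i j) x + (int w - 1) * int z2 + (int z1 - 2) * (int z2)\<^sup>2)"
    by simp
  \<comment> \<open>The constants agree precisely if \<open>(w - z2)^2 = w - z2\<close>, which holds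
    when \<open>w - z2\<close> is 0 or 1.\<close>
  have "int w = int z2 \<or> int w = int z2 + 1"
    using z2 w_pos by auto
  then show ?thesis
  proof
    assume "int w = int z2"
    then show ?thesis
      using False unfolding sum by (simp add: algebra_simps power2_eq_square)
  next
    assume "int w = int z2 + 1"
    then show ?thesis
      using False unfolding sum by (simp add: algebra_simps power2_eq_square)
  qed
qed

text \<open>The parameters satisfy \<open>lam - mu = q - 2 * w\<close> and
  \<open>t - mu = w * (q - w)\<close>, the coefficients that occur in
  \<open>sum_conv_family\<close>.\<close>

theorem uniform_partial_sum_family_family:
  "uniform_partial_sum_family G z1 (q\<^sup>2) ((q - 1) * w + (z1 - 1) * z2 * q)
    (int q + (int w)\<^sup>2 - 3 * int w + (int z1 - 1) * (int z2)\<^sup>2)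
    ((int w)\<^sup>2 - int w + (int z1 - 1) * (int z2)\<^sup>2)
    (int q * int w - int w + (int z1 - 1) * (int z2)\<^sup>2) family"
  (is "uniform_partial_sum_family G z1 _ ?k ?lam ?mu ?t family")
proof -
  let ?R = "int_group_ring G"
  interpret R: cring ?R
    using comm_group_axioms finite_carrier by (rule cring_int_group_ring)
  note fin = comm_group_axioms finite_carrier
  have closed: "indicator (family i j) \<in> carrier ?R" if "i < z1" "j < z1" for i j
    using that by (intro indicator_mem_int_group_ring family_subset)
  have eq: "(\<Oplus>\<^bsub>?R\<^esub>l\<in>{..<z1}. indicator (family l j) \<otimes>\<^bsub>?R\<^esub> indicator (family i l)) =
        ([?mu] \<cdot>\<^bsub>?R\<^esub> indicator (carrier G) \<oplus>\<^bsub>?R\<^esub> [(?lam - ?mu)] \<cdot>\<^bsub>?R\<^esub> indicator (family i j))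
          \<oplus>\<^bsub>?R\<^esub> [(if i = j then ?t - ?mu else 0)] \<cdot>\<^bsub>?R\<^esub> \<one>\<^bsub>?R\<^esub>"
    (is "?lhs = ?rhs") if i: "i < z1" and j: "j < z1" for i j
  proof
    fix x
    have one: "\<one>\<^bsub>?R\<^esub> = indicator {\<one>}"
      by (simp add: int_group_ring_def)
    have lhs: "?lhs x = (\<Sum>l<z1. (indicator (family l j) \<otimes>\<^bsub>?R\<^esub> indicator (family i l)) x)"
      using i j closed by (subst int_group_ring_finsum[OF fin]) auto
    have rhs: "?rhs x = ?mu * indicator (carrier G) x + (?lam - ?mu) * indicator (family i j) x
      + (if i = j then ?t - ?mu else 0) * indicator {\<one>} x"
      unfolding int_group_ring_add one[symmetric]
      using i j closed indicator_mem_int_group_ring[of "carrier G"]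
      by (simp only: int_group_ring_add_pow[OF fin] R.one_closed subset_refl)
    show "?lhs x = ?rhs x"
      unfolding lhs rhs
    proof (cases "x \<in> carrier G")
      case True
      then show "(\<Sum>l<z1. (indicator (family l j) \<otimes>\<^bsub>?R\<^esub> indicator (family i l)) x)
        = ?mu * indicator (carrier G) x + (?lam - ?mu) * indicator (family i j) x
          + (if i = j then ?t - ?mu else 0) * indicator {\<one>} x"
        using sum_conv_family[OF i j True]
        by (simp add: int_group_ring_mult algebra_simps power2_eq_square)
    next
      case False
      \<comment> \<open>Off the carrier all coefficients have the default value 0.\<close>
      then have "x \<notin> family i j" "x \<noteq> \<one>"
        using family_subset[OF i j] by auto
      with False show "(\<Sum>l<z1. (indicator (family l j) \<otimes>\<^bsub>?R\<^esub> indicator (family i l)) x)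
        = ?mu * indicator (carrier G) x + (?lam - ?mu) * indicator (family i j) x
          + (if i = j then ?t - ?mu else 0) * indicator {\<one>} x"
        by (simp add: int_group_ring_mult)
    qed
  qed
  have disjoint: "disjoint_family_on (\<lambda>i. family i i) {..<z1}"
  proof -
    have "x = \<one>" if "i < z1" "j < z1" "i \<noteq> j" "a \<in> line_class i" "b \<in> line_class j"
      "x \<in> L a" "x \<in> L b" for i j a b x
    proof -
      have "a \<noteq> b"
        using that by (auto simp: mem_line_class)
      moreover have "a \<le> q" "b \<le> q"
        using line_class_subset[OF that(1)] line_class_subset[OF that(2)] that(4,5) by auto
      ultimately show ?thesis
        using line_inter that by blast
    qed
    then show ?thesis
      by (auto simp: disjoint_family_on_def family_def)
  qed
  have union: "(\<Union>i<z1. family i i) = carrier G - {\<one>}"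
    using lines_cover unfolding union_line_classes[symmetric] by (auto simp: family_def)
  have nonempty: "family i i \<noteq> {}" if "i < z1" for i
    using card_family_diag[OF that] w_pos q_gt_1 by force
  have "partition_on (carrier G - {\<one>}) ((\<lambda>i. family i i) ` {..<z1})"
  proof (rule partition_onI)
    show "\<Union>((\<lambda>i. family i i) ` {..<z1}) = carrier G - {\<one>}"
      using union by simp
    show "{} \<notin> (\<lambda>i. family i i) ` {..<z1}"
    proof
      assume "{} \<in> (\<lambda>i. family i i) ` {..<z1}"
      then obtain i where "i < z1" "{} = family i i"
        by blast
      with nonempty[of i] show False by simp
    qed
    show "disjnt B B'"
      if B: "B \<in> (\<lambda>i. family i i) ` {..<z1}" "B' \<in> (\<lambda>i. family i i) ` {..<z1}" "B \<noteq> B'" for B B'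
    proof -
      obtain i j where ij: "i < z1" "j < z1" "B = family i i" "B' = family j j"
        using B(1,2) by auto
      then have "i \<noteq> j"
        using B(3) by auto
      then show ?thesis
        using disjoint_family_onD[OF disjoint, of i j] ij by (simp add: disjnt_def)
    qed
  qed
  moreover have "partial_sum_family G z1 (q\<^sup>2) ?k ?lam ?mu ?t family"
    unfolding partial_sum_family_def Let_def
  proof (intro conjI allI impI)
    show "\<one> \<notin> family i i" if "i < z1" for i
      by (simp add: family_def)
    show "comm_group G" "finite (carrier G)" by (rule fin)+
    show "order G = q\<^sup>2" by (rule order_eq)
    show "family i j \<subseteq> carrier G" if "i < z1" "j < z1" for i j
      using that by (rule family_subset)
    show "(\<Sum>j<z1. card (family i j)) = ?k" "(\<Sum>j<z1. card (family j i)) = ?k" if "i < z1" for i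
      using that by (rule sum_card_family)+
  qed (rule eq)
  ultimately show ?thesis
    unfolding uniform_partial_sum_family_def
    using disjoint by (simp add: card_family_diag card_family_off_diag)
qed

end

section \<open>Existence of spreads\<close>

text \<open>Moves a spread to a group on another type by renaming the elements.\<close>

lemma (in group_spread) group_spread_image:
  assumes inj: "inj_on f (carrier G)"
  shows "group_spread (image_group f G) q (\<lambda>i. f ` L i)"
proof -
  let ?H = "image_group f G"
  have iso: "f \<in> iso G ?H"
    using inj by (rule inj_imp_image_group_iso)
  interpret H: group ?H
    using inj by (rule inj_imp_image_group_is_group)
  interpret f: group_hom G ?H f
    using iso by unfold_locales (simp add: iso_def)
  interpret H: comm_group ?H
    using iso_imp_comm_group[of ?H] iso H.is_monoid by (auto simp: is_iso_def)
  show ?thesis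
  proof (intro group_spread.intro group_spread_axioms.intro)
    show "comm_group ?H" ..
    show "order ?H = q\<^sup>2"
      using card_image[OF inj] order_eq by (simp add: order_def image_group_carrier)
    fix i assume i: "i \<le> q"
    show "subgroup (f ` L i) ?H"
      using f.subgroup_img_is_subgroup[OF subgroup_line[OF i]] .
    show "card (f ` L i) = q"
      using card_image[OF inj_on_subset[OF inj line_subset[OF i]]] card_line[OF i] by simp
    fix j assume j: "j \<le> q" and "i \<noteq> j"
    have "f ` L i \<inter> f ` L j = f ` (L i \<inter> L j)"
      using inj_on_image_Int[OF inj line_subset[OF i] line_subset[OF j]] by simp
    then show "f ` L i \<inter> f ` L j = {\<one>\<^bsub>?H\<^esub>}"
      using line_inter[OF i j \<open>i \<noteq> j\<close>] by simp
  qed (fact q_gt_1)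
qed

text \<open>The lines through the origin of the plane over the field: for \<open>i < q\<close> the
  line of slope \<open>e i\<close>, where \<open>e\<close> enumerates the field, and at index
  \<open>q\<close> the vertical line.\<close>

lemma (in field) exists_group_spread:
  assumes q: "card (carrier R) = q" "q > 1"
  shows "\<exists>L. group_spread (add_monoid R \<times>\<times> add_monoid R) q L" (is "\<exists>L. group_spread ?G q L")
proof -
  have fin: "finite (carrier R)"
    using q by (metis card.infinite not_one_less_zero)
  obtain e where e: "bij_betw e {..<q} (carrier R)"
    using ex_bij_betw_nat_finite[OF fin] q(1) by (auto simp: atLeast0LessThan)
  then have ec: "e i \<in> carrier R" if "i < q" for i
    using that by (auto dest: bij_betwE)
  have einj: "e i = e j \<longleftrightarrow> i = j" if "i < q" "j < q" for i j
    using e that by (auto simp: bij_betw_def inj_on_def)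
  define L where
    "L i = (if i < q then (\<lambda>x. (x, e i \<otimes> x)) ` carrier R else (\<lambda>y. (\<zero>, y)) ` carrier R)" for i
  interpret G: group ?G
    using add.is_group by (intro DirProd_group)
  interpret G: comm_group ?G
    by (rule G.group_comm_groupI) (auto simp: a_comm)
  have inter: "L i \<inter> L j = {\<one>\<^bsub>?G\<^esub>}" if "i < j" "j \<le> q" for i j
  proof (intro equalityI subsetI)
    have "i < q" using that by simp
    fix v assume v: "v \<in> L i \<inter> L j"
    then obtain x where x: "x \<in> carrier R" "v = (x, e i \<otimes> x)"
      using \<open>i < q\<close> by (auto simp: L_def)
    have "x = \<zero>"
    proof (cases "j < q")
      case True
      then have "e i \<otimes> x = e j \<otimes> x" "i < q"
        using v x that by (auto simp: L_def)
      \<comment> \<open>A nonzero \<open>x\<close> could be cancelled, which would make two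
        different slopes equal.\<close>
      then show ?thesis
        using m_rcancel[of x "e i" "e j"] x ec that True einj by auto
    next
      case False
      then show ?thesis
        using v x by (auto simp: L_def)
    qed
    then show "v \<in> {\<one>\<^bsub>?G\<^esub>}"
      using x ec that by auto
  next
    fix v assume "v \<in> {\<one>\<^bsub>?G\<^esub>}"
    then show "v \<in> L i \<inter> L j"
      using ec that by (auto simp: L_def intro: rev_image_eqI[of \<zero>])
  qed
  have "group_spread ?G q L"
  proof (intro group_spread.intro group_spread_axioms.intro)
    show "comm_group ?G" ..
    show "order ?G = q\<^sup>2"
      using q by (simp add: order_def card_cartesian_product power2_eq_square)
    fix i assume i: "i \<le> q"
    show "card (L i) = q"
      using q by (auto simp: L_def card_image inj_on_def)
    show "subgroup (L i) ?G"
    proof (rule G.subgroupI)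
      show "L i \<subseteq> carrier ?G"
        using ec by (auto simp: L_def)
      show "L i \<noteq> {}"
        by (auto simp: L_def)
      fix u assume u: "u \<in> L i"
      show "inv\<^bsub>?G\<^esub> u \<in> L i"
      proof (cases "i < q")
        case True
        then obtain x where x: "x \<in> carrier R" "u = (x, e i \<otimes> x)"
          using u by (auto simp: L_def)
        then have "inv\<^bsub>?G\<^esub> u = (\<ominus> x, e i \<otimes> (\<ominus> x))"
          using ec[OF True] by (simp add: inv_DirProd[OF add.is_group add.is_group] r_minus flip: a_inv_def)
        then show ?thesis
          using True x by (simp add: L_def)
      next
        case False
        then show ?thesis
          using u by (auto simp: L_def inv_DirProd[OF add.is_group add.is_group] simp flip: a_inv_def)
      qed
      fix v assume v: "v \<in> L i"
      show "u \<otimes>\<^bsub>?G\<^esub> v \<in> L i"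
      proof (cases "i < q")
        case True
        then obtain x y where xy: "x \<in> carrier R" "u = (x, e i \<otimes> x)" "y \<in> carrier R" "v = (y, e i \<otimes> y)"
          using u v by (auto simp: L_def)
        then have "u \<otimes>\<^bsub>?G\<^esub> v = (x \<oplus> y, e i \<otimes> (x \<oplus> y))"
          using ec[OF True] by (simp add: r_distr)
        then show ?thesis
          using True xy by (simp add: L_def)
      next
        case False
        then show ?thesis
          using u v by (auto simp: L_def)
      qed
    qed
    fix j assume "j \<le> q" "i \<noteq> j"
    then show "L i \<inter> L j = {\<one>\<^bsub>?G\<^esub>}"
      using inter[of i j] inter[of j i] i by (cases "i < j") (auto simp: Int_commute)
  qed (fact q)
  then show ?thesis by blast
qed

text \<open>An existential statement about groups has to fix their element type; a finite group can
  be renamed injectively into \<open>nat\<close>.\<close>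

lemma exists_nat_group_spread:
  fixes p d :: nat
  assumes p: "Factorial_Ring.prime p" and "d > 0"
  shows "\<exists>(G :: nat monoid) L. group_spread G (p ^ d) L"
proof -
  obtain F :: "((int list \<times> nat) multiset \<Rightarrow> int) ring"
    where F: "field F" "card (carrier F) = p ^ d"
    using exists_field_of_prime_power_order[OF assms] .
  have "p ^ d > 1"
    using prime_gt_1_nat[OF p] \<open>d > 0\<close> by (rule one_less_power)
  define H :: "(((int list \<times> nat) multiset \<Rightarrow> int) \<times> ((int list \<times> nat) multiset \<Rightarrow> int)) monoid"
    where "H = add_monoid F \<times>\<times> add_monoid F"
  obtain L where "group_spread H (p ^ d) L"
    using field.exists_group_spread[OF F \<open>p ^ d > 1\<close>] unfolding H_def by blast
  then interpret S: group_spread H "p ^ d" L .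
  obtain f :: "_ \<Rightarrow> nat" where "inj_on f (carrier H)"
    using finite_imp_inj_to_nat_seg[OF S.finite_carrier] by blast
  then show ?thesis
    using S.group_spread_image by blast
qed

theorem corollary3p5:
  fixes p d w z1 z2 k :: nat and lam mu t :: int
  assumes "Factorial_Ring.prime p" and "d > 0" and "w > 0" and "w dvd p ^ d + 1"
    and "z1 = (p ^ d + 1) div w"
    and "z2 \<in> {w - 1, w}"
    and "k = (p ^ d - 1) * w + (z1 - 1) * z2 * p ^ d"
    and "lam = int p ^ d + int w ^ 2 - 3 * int w + (int z1 - 1) * int z2 ^ 2"
    and "mu = int w ^ 2 - int w + (int z1 - 1) * int z2 ^ 2"
    and "t = int p ^ d * int w - int w + (int z1 - 1) * int z2 ^ 2"
  shows "\<exists>(G :: nat monoid) S. uniform_partial_sum_family G z1 (p ^ (2 * d)) k lam mu t S"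
proof -
  obtain G :: "nat monoid" and L where "group_spread G (p ^ d) L"
    using exists_nat_group_spread[OF assms(1,2)] by blast
  then interpret group_spread G "p ^ d" L .
  have classes: "z1 * w = p ^ d + 1"
    using assms(4,5) by simp
  have rep: "j * w \<le> p ^ d" if "j < z1" for j
  proof -
    have "(j + 1) * w \<le> z1 * w"
      using that by (intro mult_right_mono) auto
    with classes \<open>w > 0\<close> show ?thesis by simp
  qed
  \<comment> \<open>For \<open>z1 = 1\<close> no size is prescribed, and any subset of the cosets
    will do.\<close>
  have ex: "\<exists>V. V \<subseteq> rcosets\<^bsub>G\<^esub> (L (j * w)) \<and> (z1 > 1 \<longrightarrow> card V = z2)" if j: "j < z1" for j
  proof (cases "z1 > 1")
    case True
    \<comment> \<open>Two classes of \<open>w\<close> lines fit among \<open>p ^ d + 1\<close>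
      lines. As \<open>w\<close> is positive, this gives \<open>w \<le> p ^ d\<close>, so a line has
      enough cosets to choose \<open>z2\<close> of them.\<close>
    have "2 * w \<le> z1 * w"
      using True by (intro mult_right_mono) auto
    then have "z2 \<le> p ^ d"
      using assms(3,6) classes by auto
    then have "z2 \<le> card (rcosets\<^bsub>G\<^esub> (L (j * w)))"
      using card_rcosets_line[OF rep[OF j]] by simp
    then show ?thesis
      by (meson obtain_subset_with_card_n)
  qed auto
  then obtain U where U: "\<And>j. j < z1 \<Longrightarrow> U j \<subseteq> rcosets\<^bsub>G\<^esub> (L (j * w)) \<and> (z1 > 1 \<longrightarrow> card (U j) = z2)"
    by metis
  interpret spread_classes G "p ^ d" L w z1 z2 U
    using U assms(3,6) classes by unfold_locales auto
  have "uniform_partial_sum_family G z1 (p ^ (2 * d)) k lam mu t family"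
    using uniform_partial_sum_family_family assms(7-10)
    by (simp add: mult.commute flip: power_mult)
  then show ?thesis by blast
qed

end
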